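(* Let $G$ be a 4-connected plane graph. Then $G$ is cleavable if and only if $G$ has at most one large face (i.e., if and only if $G$ is a near triangulation).
   Context: For a connected graph $G=(V,E)$, a cut is a set $S\subset V$ such that $G-S$ is disconnected; it is minimal if $G-T$ is connected for every proper subset $T\subset S$. A cut $S$ is connected if the induced subgraph $G[S]$ is connected. $G$ is cleavable if every minimal cut of $G$ is connected. In a 2-connected plane graph every face is bounded by a cycle; a large face is a face whose bounding cycle has length at least 4. A near triangulation is a 2-connected plane graph with at most one large face. *)

theory Defs
  imports "HOL-Analysis.Analysis"
begin

text \<open>
  An abstract graph is given by a vertex set \<open>V\<close> and a set \<open>E\<close> of two-element subsets of \<open>V\<close>.
  The induced subgraph \<open>G[W]\<close> is \<open>(W, edges_on E W)\<close>, and \<open>G - S\<close> is \<open>G[V - S]\<close>.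
\<close>

definition edges_on :: "'a set set \<Rightarrow> 'a set \<Rightarrow> 'a set set"
  where "edges_on E W = {e \<in> E. e \<subseteq> W}"

text \<open>The null graph counts as connected, so that ``disconnected'' always means that some two
  vertices are not joined by a walk.\<close>

definition graph_connected :: "'a set \<Rightarrow> 'a set set \<Rightarrow> bool"
  where "graph_connected V E \<longleftrightarrow> (\<forall>u\<in>V. \<forall>v\<in>V. (u, v) \<in> {(x, y). {x, y} \<in> E}\<^sup>*)"

definition graph_cut :: "'a set \<Rightarrow> 'a set set \<Rightarrow> 'a set \<Rightarrow> bool"
  where "graph_cut V E S \<longleftrightarrow> S \<subseteq> V \<and> \<not> graph_connected (V - S) (edges_on E (V - S))"

definition minimal_cut :: "'a set \<Rightarrow> 'a set set \<Rightarrow> 'a set \<Rightarrow> bool"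
  where "minimal_cut V E S \<longleftrightarrow>
    graph_cut V E S \<and> (\<forall>T. T \<subset> S \<longrightarrow> graph_connected (V - T) (edges_on E (V - T)))"

definition cleavable :: "'a set \<Rightarrow> 'a set set \<Rightarrow> bool"
  where "cleavable V E \<longleftrightarrow> (\<forall>S. minimal_cut V E S \<longrightarrow> graph_connected S (edges_on E S))"

definition k_connected :: "nat \<Rightarrow> 'a set \<Rightarrow> 'a set set \<Rightarrow> bool"
  where "k_connected k V E \<longleftrightarrow>
    finite V \<and> card V > k \<and>
    (\<forall>X. X \<subseteq> V \<and> card X < k \<longrightarrow> graph_connected (V - X) (edges_on E (V - X)))"

text \<open>
  A finite simple plane graph: the vertices are points of the plane, and every edge is the image
  of an arc (hence has two distinct ends) meeting the vertex set exactly in its ends. So the set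
  of ends of an edge \<open>a\<close> is \<open>a \<inter> V\<close>. Distinct edges have distinct sets of ends and meet only in
  vertices.
\<close>

definition plane_graph :: "complex set \<Rightarrow> complex set set \<Rightarrow> bool"
  where "plane_graph V A \<longleftrightarrow>
    finite V \<and> finite A \<and>
    (\<forall>a\<in>A. \<exists>g. arc g \<and> path_image g = a \<and> a \<inter> V = {pathstart g, pathfinish g}) \<and>
    (\<forall>a\<in>A. \<forall>b\<in>A. a \<noteq> b \<longrightarrow> a \<inter> V \<noteq> b \<inter> V \<and> a \<inter> b \<subseteq> V)"

definition edge_ends :: "complex set \<Rightarrow> complex set set \<Rightarrow> complex set set"
  where "edge_ends V A = (\<lambda>a. a \<inter> V) ` A"

text \<open>The faces include the unbounded one.\<close>

definition faces :: "complex set \<Rightarrow> complex set set \<Rightarrow> complex set set"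
  where "faces V A = components (- (V \<union> \<Union>A))"

text \<open>A cycle is listed by its vertices \<open>vs\<close> and its edges \<open>as\<close>, where \<open>as ! i\<close> joins \<open>vs ! i\<close> to
  its cyclic successor; its length is the common length of the two lists.\<close>

definition plane_cycle ::
    "complex set \<Rightarrow> complex set set \<Rightarrow> complex list \<Rightarrow> complex set list \<Rightarrow> bool"
  where "plane_cycle V A vs as \<longleftrightarrow>
    length vs \<ge> 3 \<and> length as = length vs \<and> distinct vs \<and> set vs \<subseteq> V \<and> set as \<subseteq> A \<and>
    (\<forall>i < length vs. (as ! i) \<inter> V = {vs ! i, vs ! (Suc i mod length vs)})"

text \<open>In a 2-connected plane graph every face is bounded by exactly one cycle, up to rotation and
  reversal of its listing, so its length is well defined.\<close>

definition large_face :: "complex set \<Rightarrow> complex set set \<Rightarrow> complex set \<Rightarrow> bool"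
  where "large_face V A F \<longleftrightarrow>
    F \<in> faces V A \<and>
    (\<exists>vs as. plane_cycle V A vs as \<and> frontier F = \<Union>(set as) \<and> length as \<ge> 4)"

definition near_triangulation :: "complex set \<Rightarrow> complex set set \<Rightarrow> bool"
  where "near_triangulation V A \<longleftrightarrow>
    plane_graph V A \<and> k_connected 2 V (edge_ends V A) \<and> (\<exists>\<^sub>\<le>\<^sub>1 F. large_face V A F)"

end

theory Submission
  imports Defs
begin

text \<open>
  The topology enters through Janiszewski's theorem and its converse.

  Suppose \<open>F\<close> and \<open>F'\<close> are distinct large faces. By Menger's theorem there are four disjoint
  connected vertex sets linking their boundaries, say \<open>P1, \<dots>, P4\<close> in their order around \<open>F\<close>.
  As \<open>P2\<close> and \<open>P4\<close> cannot be crossed, \<open>P1\<close> and \<open>P3\<close> are not adjacent. Both can be rerouted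
  so that no subset of either alone is a cut, while their union still separates \<open>P2\<close> from \<open>P4\<close> on
  the boundary of \<open>F\<close>; so a minimal cut inside that union meets both and is disconnected.

  Conversely, let \<open>S\<close> be a disconnected minimal cut, \<open>P\<close> a component of \<open>G[S]\<close> and \<open>C\<close> one
  of \<open>G - S\<close>. Let \<open>H\<close> be the subgraph induced on \<open>P \<union> C\<close> and \<open>K\<close> the graph without the
  \<open>P\<close>-\<open>C\<close> edges. Both are connected, but their intersection is not. A triangular face has its
  boundary in \<open>H\<close> or in \<open>K\<close>. If all faces except possibly one are triangular, then filling them
  into \<open>H\<close> or \<open>K\<close> yields connected closed sets with the same intersection whose union has a
  connected complement, which the converse of Janiszewski's theorem forbids.
\<close>

section \<open>Connected vertex sets\<close>

text \<open>Janiszewski's theorem says that two closed sets, one of them compact, which meet in a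
  connected set and both fail to separate two points have a union that fails as well. It asks only
  for connectedness, so connected vertex sets replace paths everywhere and no walk has to be cut or
  spliced. Four links are needed so that two opposite ones are kept apart by the other two. Fewer
  than four vertices neither disconnect the graph nor contain the boundary of a large face, which is
  what Menger's theorem asks for. Rerouting a link uses 3-connectedness: a piece of the graph cut
  off by the link has three attachments on it, and one of them can be released. A rerouted link
  contains no cut because its complement is connected and each of its vertices has a neighbour
  there. A large face is defined through a bounding cycle. Hence a face that is not large is a
  triangle only once every face is known to have such a cycle; this is why face boundaries are
  studied. Filling may absorb the unbounded face, so the converse of Janiszewski's theorem is needed
  for one set that is closed but not compact.\<close>

abbreviation conn :: "'a set set \<Rightarrow> 'a set \<Rightarrow> bool"
  where "conn E W \<equiv> graph_connected W (edges_on E W)"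

text \<open>Walks occur only here and in \<open>connI\<close>. Later arguments show instead that a
  nonempty part closed under adjacency is everything.\<close>

lemma conn_closedD:
  assumes "conn E W" "M \<subseteq> W" "M \<noteq> {}" and cl: "\<And>x y. \<lbrakk>x \<in> M; y \<in> W; {x,y} \<in> E\<rbrakk> \<Longrightarrow> y \<in> M"
  shows "M = W"
proof -
  obtain m where m: "m \<in> M" using assms by blast
  have "v \<in> M" if "v \<in> W" for v
  proof -
    have "(m, v) \<in> {(x, y). {x, y} \<in> edges_on E W}\<^sup>*"
      using assms m that unfolding graph_connected_def by blast
    then show ?thesis
      by induction (use m cl in \<open>auto simp: edges_on_def\<close>)
  qed
  then show ?thesis using assms by blast
qed

lemma connI:
  assumes "\<And>M x y. \<lbrakk>M \<subseteq> W; x \<in> M; y \<in> W; \<And>u v. \<lbrakk>u \<in> M; v \<in> W; {u,v} \<in> E\<rbrakk> \<Longrightarrow> v \<in> M\<rbrakk> \<Longrightarrow> y \<in> M"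
  shows "conn E W"
  unfolding graph_connected_def
proof (intro ballI)
  fix u v assume uv: "u \<in> W" "v \<in> W"
  let ?R = "{(x, y). {x, y} \<in> edges_on E W}"
  have "v \<in> {w \<in> W. (u,w) \<in> ?R\<^sup>*}"
  proof (rule assms)
    fix w w' assume *: "w \<in> {w \<in> W. (u,w) \<in> ?R\<^sup>*}" "w' \<in> W" "{w,w'} \<in> E"
    then have "(w,w') \<in> ?R" by (auto simp: edges_on_def)
    with * show "w' \<in> {w \<in> W. (u,w) \<in> ?R\<^sup>*}" by (auto intro: rtrancl.rtrancl_into_rtrancl)
  qed (use uv in auto)
  then show "(u, v) \<in> ?R\<^sup>*" by simp
qed

lemma conn_singleton [simp]: "conn E {x}"
  by (rule connI) auto

lemma conn_empty [simp]: "conn E {}"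
  by (rule connI) auto

lemma conn_mono_edges:
  assumes "conn E W" "\<And>e. e \<in> E \<Longrightarrow> e \<subseteq> W \<Longrightarrow> e \<in> E'"
  shows "conn E' W"
proof (rule connI)
  fix M x y
  assume M: "M \<subseteq> W" "x \<in> M" "y \<in> W" and cl: "\<And>u v. \<lbrakk>u \<in> M; v \<in> W; {u,v} \<in> E'\<rbrakk> \<Longrightarrow> v \<in> M"
  have "M = W"
    by (rule conn_closedD[OF assms(1)]) (use M cl assms(2) in auto)
  then show "y \<in> M" using M by simp
qed

lemma conn_UnionI:
  assumes "\<And>C. C \<in> \<C> \<Longrightarrow> conn E C" "\<And>C. C \<in> \<C> \<Longrightarrow> u \<in> C"
  shows "conn E (\<Union>\<C>)"
proof (rule connI)
  fix M x y
  assume M: "M \<subseteq> \<Union>\<C>" "x \<in> M" "y \<in> \<Union>\<C>"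
    and cl: "\<And>u v. \<lbrakk>u \<in> M; v \<in> \<Union>\<C>; {u,v} \<in> E\<rbrakk> \<Longrightarrow> v \<in> M"
  have sub: "C \<subseteq> M" if "C \<in> \<C>" "M \<inter> C \<noteq> {}" for C
  proof -
    have "M \<inter> C = C"
      by (rule conn_closedD[OF assms(1)[OF that(1)]]) (use cl that in auto)
    then show ?thesis by blast
  qed
  obtain C where C: "C \<in> \<C>" "x \<in> C" using M by blast
  have "u \<in> M" using sub[of C] C M assms(2) by blast
  obtain C' where C': "C' \<in> \<C>" "y \<in> C'" using M by blast
  with \<open>u \<in> M\<close> sub[of C'] assms(2)[of C'] show "y \<in> M" by blast
qed

lemma conn_Un:
  assumes "conn E A" "conn E B" "A \<inter> B \<noteq> {}"
  shows "conn E (A \<union> B)"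
proof -
  obtain u where "u \<in> A" "u \<in> B" using assms by blast
  then have "conn E (\<Union>{A,B})" by (intro conn_UnionI[where u=u]) (use assms in auto)
  then show ?thesis by simp
qed

lemma conn_pair: "{x,y} \<in> E \<Longrightarrow> conn E {x,y}"
  by (rule connI) (metis insert_commute insertE singletonD subsetD insertI1 insertI2)

lemma conn_Un_edge:
  assumes "conn E A" "conn E B" "a \<in> A" "b \<in> B" "{a,b} \<in> E"
  shows "conn E (A \<union> B)"
proof -
  have "conn E (A \<union> {a,b})" by (rule conn_Un) (use assms conn_pair in auto)
  then have "conn E ((A \<union> {a,b}) \<union> B)" by (rule conn_Un) (use assms in auto)
  moreover have "(A \<union> {a,b}) \<union> B = A \<union> B" using assms by auto
  ultimately show ?thesis by simp
qed

lemma conn_insert: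
  assumes "conn E A" "a \<in> A" "{a,b} \<in> E"
  shows "conn E (insert b A)"
  using conn_Un_edge[OF assms(1) conn_singleton assms(2) _ assms(3)] by simp

lemma conn_component:
  assumes "u \<in> W"
  obtains C where "u \<in> C" "C \<subseteq> W" "conn E C"
    "\<And>x y. \<lbrakk>x \<in> C; y \<in> W; {x,y} \<in> E\<rbrakk> \<Longrightarrow> y \<in> C"
    "\<And>B. \<lbrakk>conn E B; B \<subseteq> W; B \<inter> C \<noteq> {}\<rbrakk> \<Longrightarrow> B \<subseteq> C"
proof
  define C where "C = \<Union>{B. B \<subseteq> W \<and> conn E B \<and> u \<in> B}"
  show C1: "u \<in> C" unfolding C_def using assms by (intro UnionI[of "{u}"]) auto
  show C2: "C \<subseteq> W" unfolding C_def by blast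
  show C3: "conn E C" unfolding C_def by (rule conn_UnionI) auto
  show "y \<in> C" if "x \<in> C" "y \<in> W" "{x,y} \<in> E" for x y
  proof -
    have "conn E (insert y C)" by (rule conn_insert) (use C3 that in auto)
    moreover have "insert y C \<subseteq> W" "u \<in> insert y C" using that C1 C2 by auto
    ultimately have "insert y C \<in> {B. B \<subseteq> W \<and> conn E B \<and> u \<in> B}" by simp
    then have "insert y C \<subseteq> C" unfolding C_def by (rule Union_upper)
    then show ?thesis by simp
  qed
  show "B \<subseteq> C" if "conn E B" "B \<subseteq> W" "B \<inter> C \<noteq> {}" for B
  proof -
    have "conn E (B \<union> C)" by (rule conn_Un) (use C3 that in auto)
    moreover have "B \<union> C \<subseteq> W" "u \<in> B \<union> C" using that C1 C2 by auto
    ultimately have "B \<union> C \<in> {B. B \<subseteq> W \<and> conn E B \<and> u \<in> B}" by simp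
    then have "B \<union> C \<subseteq> C" unfolding C_def by (rule Union_upper)
    then show ?thesis by simp
  qed
qed

text \<open>A largest proper connected subset containing \<open>b\<close> has a neighbour in the
  rest of \<open>P\<close>. Adding it must give all of \<open>P\<close>, so just one vertex was
  missing. This replaces the removal of a leaf of a spanning tree.\<close>

lemma conn_delete_vertex:
  assumes "conn E P" "finite P" "b \<in> P" "P \<noteq> {b}"
  obtains w where "w \<in> P" "w \<noteq> b" "conn E (P - {w})"
proof -
  let ?S = "{M. M \<subset> P \<and> conn E M \<and> b \<in> M}"
  have "{b} \<in> ?S" using assms by auto
  moreover have "\<forall>N. N \<in> ?S \<longrightarrow> card N < Suc (card P)"
    using assms(2) by (auto simp: less_Suc_eq_le intro: card_mono)
  ultimately have "\<exists>M. M \<in> ?S \<and> (\<forall>N. N \<in> ?S \<longrightarrow> card N \<le> card M)"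
    by (rule Lattices_Big.ex_has_greatest_nat)
  then obtain M where M: "M \<in> ?S" and max: "\<And>N. N \<in> ?S \<Longrightarrow> card N \<le> card M"
    by blast
  have "\<not> (\<forall>x\<in>M. \<forall>y\<in>P. {x,y} \<in> E \<longrightarrow> y \<in> M)"
  proof
    assume "\<forall>x\<in>M. \<forall>y\<in>P. {x,y} \<in> E \<longrightarrow> y \<in> M"
    then have "M = P" by (intro conn_closedD[OF assms(1)]) (use M in auto)
    with M show False by simp
  qed
  then obtain x w where xw: "x \<in> M" "w \<in> P" "w \<notin> M" "{x,w} \<in> E"
    by blast
  have "conn E (insert w M)" by (rule conn_insert) (use M xw in auto)
  moreover have "card (insert w M) > card M"
    using xw M assms(2) finite_subset[of M P] by auto
  ultimately have "insert w M = P" using max[of "insert w M"] M xw by auto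
  then have "M = P - {w}" using xw by auto
  then show ?thesis using that[of w] M xw by auto
qed

text \<open>A smallest connected subset meeting both sets serves: if it met \<open>A\<close> twice,
  deleting a suitable vertex other than a chosen one in \<open>B\<close> would leave a smaller one.
  It plays the role of a path with only its ends in \<open>A\<close> and \<open>B\<close>.\<close>

lemma conn_minimal_link:
  assumes "conn E P" "finite P" "P \<inter> A \<noteq> {}" "P \<inter> B \<noteq> {}"
  obtains P' a b where "P' \<subseteq> P" "conn E P'" "P' \<inter> A = {a}" "P' \<inter> B = {b}"
proof -
  let ?S = "{M. M \<subseteq> P \<and> conn E M \<and> M \<inter> A \<noteq> {} \<and> M \<inter> B \<noteq> {}}"
  have "P \<in> ?S" using assms by auto
  then obtain M where M: "M \<in> ?S" and min: "\<And>N. N \<in> ?S \<Longrightarrow> card M \<le> card N"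
    using ex_has_least_nat[of "\<lambda>N. N \<in> ?S" P card] by blast
  have finM: "finite M" using M assms(2) finite_subset by blast
  have *: "\<exists>a. M \<inter> A' = {a}"
    if ne: "M \<inter> A' \<noteq> {}" "M \<inter> B' \<noteq> {}" and
      m: "\<And>N. \<lbrakk>N \<subset> M; conn E N; N \<inter> A' \<noteq> {}\<rbrakk> \<Longrightarrow> N \<inter> B' = {}" for A' B'
  proof -
    obtain b where b: "b \<in> M" "b \<in> B'" using ne by blast
    show ?thesis
    proof (cases "M = {b}")
      case True then show ?thesis using ne by auto
    next
      case False
      then obtain w where w: "w \<in> M" "w \<noteq> b" "conn E (M - {w})"
        using conn_delete_vertex[of M E b] finM M b by auto
      then have "(M - {w}) \<inter> A' = {}" using m[of "M - {w}"] b by auto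
      then show ?thesis using ne by auto
    qed
  qed
  have less: "N \<inter> A = {} \<or> N \<inter> B = {}" if "N \<subset> M" "conn E N" for N
    using min[of N] M that psubset_card_mono[OF finM that(1)] by auto
  obtain a where "M \<inter> A = {a}" using *[of A B] M less by auto
  moreover obtain b where "M \<inter> B = {b}" using *[of B A] M less by auto
  ultimately show ?thesis using that[of M] M by auto
qed

section \<open>Menger's theorem for connected vertex sets\<close>

text \<open>A connected set meeting \<open>A\<close> and \<open>B\<close> contains an
  \<open>A\<close>-\<open>B\<close> path, so this is the usual separator of Menger's theorem, which
  may itself meet \<open>A\<close> and \<open>B\<close>.\<close>

definition separates :: "'a set set \<Rightarrow> 'a set \<Rightarrow> 'a set \<Rightarrow> 'a set \<Rightarrow> 'a set \<Rightarrow> bool"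
  where "separates E V A B X \<longleftrightarrow>
    (\<forall>C. C \<subseteq> V \<longrightarrow> conn E C \<longrightarrow> C \<inter> A \<noteq> {} \<longrightarrow> C \<inter> B \<noteq> {} \<longrightarrow> C \<inter> X \<noteq> {})"

definition linked :: "'a set set \<Rightarrow> 'a set \<Rightarrow> 'a set \<Rightarrow> 'a set \<Rightarrow> nat \<Rightarrow> bool"
  where "linked E V A B k \<longleftrightarrow>
    (\<exists>f. (\<forall>i<k. f i \<subseteq> V \<and> conn E (f i) \<and> f i \<inter> A \<noteq> {} \<and> f i \<inter> B \<noteq> {}) \<and>
         (\<forall>i<k. \<forall>j<k. i \<noteq> j \<longrightarrow> f i \<inter> f j = {}))"

lemma separates_commute: "separates E V A B X \<longleftrightarrow> separates E V B A X"
  unfolding separates_def by (intro all_cong1) auto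

lemma linkedI:
  assumes "finite Z" "card Z = k"
    and "\<And>z. z \<in> Z \<Longrightarrow> p z \<subseteq> V \<and> conn E (p z) \<and> p z \<inter> A \<noteq> {} \<and> p z \<inter> B \<noteq> {}"
    and "\<And>z z'. \<lbrakk>z \<in> Z; z' \<in> Z; z \<noteq> z'\<rbrakk> \<Longrightarrow> p z \<inter> p z' = {}"
  shows "linked E V A B k"
proof -
  obtain h where h: "bij_betw h {..<k} Z"
    using ex_bij_betw_nat_finite[OF assms(1)] assms(2) by (auto simp: atLeast0LessThan)
  then have hZ: "h i \<in> Z" if "i < k" for i using that by (auto simp: bij_betw_def)
  have hi: "h i \<noteq> h j" if "i < k" "j < k" "i \<noteq> j" for i j
    using h that by (auto simp: bij_betw_def inj_on_def)
  show ?thesis unfolding linked_def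
    using assms(3)[OF hZ] assms(4)[OF hZ hZ hi] by (intro exI[of _ "p \<circ> h"]) auto
qed

text \<open>By counting, \<open>k\<close> disjoint sets that all meet a \<open>k\<close>-element set
  pick out its elements bijectively. Indexing by these elements allows two linkages to be glued
  along them.\<close>

lemma linked_onto:
  assumes "linked E V A Z k" "finite Z" "card Z = k"
  obtains p where "\<And>z. z \<in> Z \<Longrightarrow> p z \<subseteq> V \<and> conn E (p z) \<and> p z \<inter> A \<noteq> {} \<and> z \<in> p z"
    and "\<And>z z'. \<lbrakk>z \<in> Z; z' \<in> Z; z \<noteq> z'\<rbrakk> \<Longrightarrow> p z \<inter> p z' = {}"
proof -
  from assms(1)[unfolded linked_def]
  obtain f where f': "\<forall>i<k. f i \<subseteq> V \<and> conn E (f i) \<and> f i \<inter> A \<noteq> {} \<and> f i \<inter> Z \<noteq> {}"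
    and dis': "\<forall>i<k. \<forall>j<k. i \<noteq> j \<longrightarrow> f i \<inter> f j = {}"
    by (elim exE conjE) (rule that)
  have f: "f i \<subseteq> V \<and> conn E (f i) \<and> f i \<inter> A \<noteq> {} \<and> f i \<inter> Z \<noteq> {}" if "i < k" for i
    using f' that by simp
  have dis: "f i \<inter> f j = {}" if "i < k" "j < k" "i \<noteq> j" for i j using dis' that by simp
  have "\<forall>i\<in>{..<k}. \<exists>z. z \<in> f i \<inter> Z" using f by blast
  then obtain g where g: "\<forall>i\<in>{..<k}. g i \<in> f i \<inter> Z" using bchoice[of "{..<k}" "\<lambda>i z. z \<in> f i \<inter> Z"] by blast
  have inj: "inj_on g {..<k}" using g dis by (intro inj_onI) (metis IntD1 disjoint_iff lessThan_iff)
  have "g ` {..<k} = Z"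
    by (rule card_subset_eq) (use assms g inj in \<open>auto simp: card_image\<close>)
  then have bij: "bij_betw g {..<k} Z" using inj by (simp add: bij_betw_def)
  define h where "h = inv_into {..<k} g"
  have h: "h z < k" "g (h z) = z" if "z \<in> Z" for z
    using that \<open>g ` {..<k} = Z\<close> unfolding h_def
    by (metis inv_into_into lessThan_iff, metis f_inv_into_f)
  show ?thesis
  proof (rule that[of "f \<circ> h"])
    show "(f \<circ> h) z \<subseteq> V \<and> conn E ((f \<circ> h) z) \<and> (f \<circ> h) z \<inter> A \<noteq> {} \<and> z \<in> (f \<circ> h) z"
      if "z \<in> Z" for z
      using f[OF h(1)[OF that]] g h[OF that] by force
    show "(f \<circ> h) z \<inter> (f \<circ> h) z' = {}" if "z \<in> Z" "z' \<in> Z" "z \<noteq> z'" for z z'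
      using dis[of "h z" "h z'"] h[OF that(1)] h[OF that(2)] that(3) by force
  qed
qed

lemma linked_mono_edges:
  assumes "linked E V A B k" "E \<subseteq> E'"
  shows "linked E' V A B k"
proof -
  have "conn E' C" if "conn E C" for C using conn_mono_edges[OF that] assms(2) by blast
  then show ?thesis using assms(1) unfolding linked_def by (metis (no_types, lifting))
qed

text \<open>The edge \<open>{x,y}\<close> is the only one between \<open>L\<close> and
  \<open>M\<close>. A connected set from \<open>A\<close> to \<open>B\<close> has to leave
  \<open>L\<close>, and can do so only through \<open>X\<close> or \<open>x\<close>; the part of it
  up to there is already hit by \<open>Y\<close>.\<close>

lemma separates_one_side:
  assumes sep: "separates E' (L \<union> X) A (insert x X) Y"
    and V: "V = L \<union> M \<union> X" "L \<inter> M = {}" "L \<inter> X = {}"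
    and E: "E = insert {x,y} E'" "x \<in> L" "y \<in> M"
    and noedge: "\<And>u v. \<lbrakk>u \<in> L; v \<in> M\<rbrakk> \<Longrightarrow> {u,v} \<notin> E'"
    and A: "A \<inter> V \<subseteq> L \<union> X" and B: "B \<inter> L = {}"
  shows "separates E V A B Y"
  unfolding separates_def
proof (intro allI impI)
  fix C assume C: "C \<subseteq> V" "conn E C" "C \<inter> A \<noteq> {}" "C \<inter> B \<noteq> {}"
  obtain a where a: "a \<in> C" "a \<in> A" using C by blast
  then have "a \<in> C \<inter> (L \<union> X)" using A C by blast
  then obtain K where K: "a \<in> K" "K \<subseteq> C \<inter> (L \<union> X)" "conn E' K"
    and cl: "\<And>u v. \<lbrakk>u \<in> K; v \<in> C \<inter> (L \<union> X); {u,v} \<in> E'\<rbrakk> \<Longrightarrow> v \<in> K"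
    using conn_component[of a "C \<inter> (L \<union> X)" E'] by metis
  have "K \<inter> insert x X \<noteq> {}"
  proof
    assume emp: "K \<inter> insert x X = {}"
    have "K = C"
    proof (rule conn_closedD[OF C(2)])
      fix u v assume uv: "u \<in> K" "v \<in> C" "{u,v} \<in> E"
      then have "u \<in> L" "u \<noteq> x" using emp K by auto
      then have "{u,v} \<noteq> {x,y}" using V E by (auto simp: doubleton_eq_iff)
      then have "{u,v} \<in> E'" using uv E by auto
      then have "v \<in> L \<union> X" using noedge[of u v] \<open>u \<in> L\<close> uv C V by blast
      then show "v \<in> K" using cl uv \<open>{u,v} \<in> E'\<close> by blast
    qed (use K in auto)
    then have "C \<subseteq> L" using K emp by blast
    then show False using C B by blast
  qed
  then have "K \<inter> Y \<noteq> {}"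
    using sep K a unfolding separates_def by (metis IntI empty_iff le_infE)
  then show "C \<inter> Y \<noteq> {}" using K by blast
qed

text \<open>Induction on the number of edges. If deleting an edge \<open>{x,y}\<close> creates a
  separator \<open>X\<close> with fewer than \<open>k\<close> vertices, then \<open>X\<close> with
  \<open>x\<close> and \<open>X\<close> with \<open>y\<close> are separators of size
  \<open>k\<close> in the original graph. Linkages from \<open>A\<close> to the former and from the
  latter to \<open>B\<close> exist by induction, on the two sides of \<open>X\<close>, and are
  joined at \<open>X\<close> and across the edge.\<close>

lemma menger:
  assumes "finite E" "\<And>e. e \<in> E \<Longrightarrow> \<exists>x y. e = {x,y} \<and> x \<noteq> y" "finite V"
    and "\<And>X. \<lbrakk>X \<subseteq> V; separates E V A B X\<rbrakk> \<Longrightarrow> k \<le> card X"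
  shows "linked E V A B k"
  using assms
proof (induction "card E" arbitrary: E V A B rule: less_induct)
  case less
  note sepk = less.prems(4)
  show ?case
  proof (cases "E = {}")
    case True
    have "separates E V A B (V \<inter> A \<inter> B)"
      unfolding separates_def
    proof (intro allI impI)
      fix C assume C: "C \<subseteq> V" "conn E C" "C \<inter> A \<noteq> {}" "C \<inter> B \<noteq> {}"
      then obtain a where a: "a \<in> C" "a \<in> A" by blast
      have "{a} = C" by (rule conn_closedD[OF C(2)]) (use a True in auto)
      then show "C \<inter> (V \<inter> A \<inter> B) \<noteq> {}" using C by auto
    qed
    then have "k \<le> card (V \<inter> A \<inter> B)" by (intro sepk) auto
    then obtain Z where "Z \<subseteq> V \<inter> A \<inter> B" "card Z = k" "finite Z"
      using obtain_subset_with_card_n by metis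
    then show ?thesis by (intro linkedI[where Z=Z and p="\<lambda>z. {z}"]) auto
  next
    case False
    then obtain e where e: "e \<in> E" by blast
    define E' where "E' = E - {e}"
    have E': "card E' < card E" "finite E'" "\<And>e. e \<in> E' \<Longrightarrow> \<exists>x y. e = {x,y} \<and> x \<noteq> y"
      using card_Diff1_less[OF less.prems(1) e] less.prems(1,2) unfolding E'_def by auto
    show ?thesis
    proof (cases "\<forall>X. X \<subseteq> V \<longrightarrow> separates E' V A B X \<longrightarrow> k \<le> card X")
      case True
      then have "linked E' V A B k" using less.hyps[of E' V A B] E' less.prems(3) by simp
      then show ?thesis
        by (rule linked_mono_edges) (auto simp: E'_def)
    next
      case False
      then obtain X where X: "X \<subseteq> V" "separates E' V A B X" "card X < k" by auto
      have finX: "finite X" using X less.prems(3) finite_subset by blast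
      \<comment> \<open>\<open>L\<close> is what can be reached from \<open>A\<close> without
        \<open>X\<close> and without the edge \<open>e\<close>.\<close>
      define L where "L = \<Union>{C. C \<subseteq> V - X \<and> conn E' C \<and> C \<inter> A \<noteq> {}}"
      define M where "M = V - X - L"
      have LV: "L \<subseteq> V - X" unfolding L_def by blast
      have V: "V = L \<union> M \<union> X" "L \<inter> M = {}" "L \<inter> X = {}" "M \<inter> X = {}"
        using LV X unfolding M_def by auto
      have noedge: "{u,v} \<notin> E'" if uvLM: "u \<in> L" "v \<in> M" for u v
      proof
        assume uv: "{u,v} \<in> E'"
        obtain C where C: "C \<subseteq> V - X" "conn E' C" "C \<inter> A \<noteq> {}" "u \<in> C"
          using uvLM unfolding L_def by blast
        have "conn E' (insert v C)" using conn_insert[OF C(2) C(4) uv] .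
        then have "insert v C \<subseteq> L" unfolding L_def
          by (intro Union_upper) (use C uvLM in \<open>auto simp: M_def\<close>)
        then show False using uvLM V by auto
      qed
      have AL: "A \<inter> V \<subseteq> L \<union> X"
      proof
        fix a assume a: "a \<in> A \<inter> V"
        show "a \<in> L \<union> X"
          by (cases "a \<in> X") (use a in \<open>auto simp: L_def intro!: exI[of _ "{a}"]\<close>)
      qed
      have BL: "B \<inter> L = {}"
      proof -
        have "B \<inter> C = {}" if "C \<subseteq> V - X" "conn E' C" "C \<inter> A \<noteq> {}" for C
          using X(2) that unfolding separates_def by blast
        then show ?thesis unfolding L_def by blast
      qed
      \<comment> \<open>Outside \<open>X\<close> only \<open>e\<close> can lead from
        \<open>L\<close> to \<open>M\<close>. A superset of \<open>X\<close> therefore separates as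
        soon as it blocks \<open>e\<close>.\<close>
      have sepI: "separates E V A B Y"
        if Y: "X \<subseteq> Y" "\<And>u v. \<lbrakk>u \<in> L - Y; v \<in> M - Y; {u,v} = e\<rbrakk> \<Longrightarrow> False" for Y
        unfolding separates_def
      proof (intro allI impI notI)
        fix C assume C: "C \<subseteq> V" "conn E C" "C \<inter> A \<noteq> {}" "C \<inter> B \<noteq> {}" "C \<inter> Y = {}"
        have "C \<inter> L = C"
        proof (rule conn_closedD[OF C(2)])
          show "C \<inter> L \<noteq> {}" using C AL Y by blast
          fix u v assume uv: "u \<in> C \<inter> L" "v \<in> C" "{u,v} \<in> E"
          have "v \<in> V" "v \<notin> X" using uv C Y by auto
          then have "v \<in> L \<or> v \<in> M" by (simp add: M_def)
          moreover have "v \<notin> M"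
          proof
            assume v: "v \<in> M"
            have "u \<in> L - Y" "v \<in> M - Y" using uv C v by auto
            then have "{u,v} \<noteq> e" using Y(2) by auto
            then show False using noedge[of u v] uv v by (auto simp: E'_def)
          qed
          ultimately show "v \<in> C \<inter> L" using uv by blast
        qed auto
        then have "C \<subseteq> L" by auto
        then show False using C BL by auto
      qed
      have "\<exists>x y. x \<in> L \<and> y \<in> M \<and> e = {x,y}"
      proof (rule ccontr)
        assume "\<not> ?thesis"
        then have "separates E V A B X" by (intro sepI) auto
        then show False using sepk[of X] X by simp
      qed
      then obtain x y where xy: "x \<in> L" "y \<in> M" "e = {x,y}" by blast
      have xyX: "x \<notin> X" "y \<notin> X" "x \<in> V" "y \<in> V" "x \<noteq> y" using xy V by auto
      have EE: "E = insert {x,y} E'" "E = insert {y,x} E'"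
        using e xy by (auto simp: E'_def insert_commute)
      have "separates E V A B (insert x X)" by (rule sepI) (use xy V in \<open>auto simp: doubleton_eq_iff\<close>)
      then have "k \<le> card (insert x X)" using sepk[of "insert x X"] X xyX by auto
      then have cX: "card (insert x X) = k" "card (insert y X) = k"
        using X(3) finX xyX by auto
      have finV: "finite (L \<union> X)" "finite (M \<union> X)" using less.prems(3) V by auto
      have "linked E' (L \<union> X) A (insert x X) k"
      proof (rule less.hyps[OF E'(1,2,3) finV(1)])
        fix Y assume Y: "Y \<subseteq> L \<union> X" "separates E' (L \<union> X) A (insert x X) Y"
        have "separates E V A B Y"
          by (rule separates_one_side[OF Y(2) V(1-3) EE(1) xy(1,2) noedge AL BL])
        then show "k \<le> card Y" using sepk[of Y] Y V by auto
      qed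
      then obtain p where p: "\<And>z. z \<in> insert x X \<Longrightarrow>
            p z \<subseteq> L \<union> X \<and> conn E' (p z) \<and> p z \<inter> A \<noteq> {} \<and> z \<in> p z"
        and pdis: "\<And>z z'. \<lbrakk>z \<in> insert x X; z' \<in> insert x X; z \<noteq> z'\<rbrakk> \<Longrightarrow> p z \<inter> p z' = {}"
        using linked_onto[of E' "L \<union> X" A "insert x X" k] finX cX by (metis finite_insert)
      have BM: "B \<inter> V \<subseteq> M \<union> X" "A \<inter> M = {}" using BL AL V by auto
      have "linked E' (M \<union> X) B (insert y X) k"
      proof (rule less.hyps[OF E'(1,2,3) finV(2)])
        fix Y assume Y: "Y \<subseteq> M \<union> X" "separates E' (M \<union> X) B (insert y X) Y"
        have V': "V = M \<union> L \<union> X" "M \<inter> L = {}" using V by auto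
        have "{u,v} \<notin> E'" if "u \<in> M" "v \<in> L" for u v
          using noedge[OF that(2,1)] by (simp add: insert_commute)
        then have "separates E V B A Y"
          by (rule separates_one_side[OF Y(2) V' V(4) EE(2) xy(2,1) _ BM])
        then have "separates E V A B Y" by (simp add: separates_commute)
        then show "k \<le> card Y" using sepk[of Y] Y V by auto
      qed
      then obtain q where q: "\<And>z. z \<in> insert y X \<Longrightarrow>
            q z \<subseteq> M \<union> X \<and> conn E' (q z) \<and> q z \<inter> B \<noteq> {} \<and> z \<in> q z"
        and qdis: "\<And>z z'. \<lbrakk>z \<in> insert y X; z' \<in> insert y X; z \<noteq> z'\<rbrakk> \<Longrightarrow> q z \<inter> q z' = {}"
        using linked_onto[of E' "M \<union> X" B "insert y X" k] finX cX by (metis finite_insert)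
      \<comment> \<open>The edge carries \<open>x\<close> to \<open>y\<close>; every vertex of
        \<open>X\<close> is matched with itself.\<close>
      define \<sigma> where "\<sigma> = (\<lambda>z. if z = x then y else z)"
      have \<sigma>: "\<sigma> z \<in> insert y X" if "z \<in> insert x X" for z using that by (auto simp: \<sigma>_def)
      have \<sigma>inj: "\<sigma> z \<noteq> \<sigma> z'" if "z \<in> insert x X" "z' \<in> insert x X" "z \<noteq> z'" for z z'
        using that xyX by (auto simp: \<sigma>_def)
      \<comment> \<open>The two linkages live in \<open>L \<union> X\<close> and
        \<open>M \<union> X\<close>, so they can meet only in \<open>X\<close>, and a vertex of
        \<open>X\<close> belongs only to its own set in each linkage.\<close>
      have pq: "p z \<inter> q (\<sigma> z') = {}" if z: "z \<in> insert x X" "z' \<in> insert x X" "z \<noteq> z'" for z z'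
      proof (rule ccontr)
        assume "p z \<inter> q (\<sigma> z') \<noteq> {}"
        then obtain v where v: "v \<in> p z" "v \<in> q (\<sigma> z')" by blast
        then have "v \<in> L \<union> X" "v \<in> M \<union> X" using p[OF z(1)] q[OF \<sigma>[OF z(2)]] by auto
        then have vX: "v \<in> X" using V by auto
        then have "v = z" using pdis[of v z] p[of v] z v by blast
        moreover have "v = \<sigma> z'" using qdis[of v "\<sigma> z'"] q[of v] \<sigma>[OF z(2)] vX v by blast
        ultimately show False using z vX xyX by (auto simp: \<sigma>_def split: if_splits)
      qed
      show ?thesis
      proof (rule linkedI[where Z = "insert x X" and p = "\<lambda>z. p z \<union> q (\<sigma> z)"])
        fix z assume z: "z \<in> insert x X"
        note pz = p[OF z] and qz = q[OF \<sigma>[OF z]]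
        have cp: "conn E (p z)" "conn E (q (\<sigma> z))"
          using pz qz by (auto intro!: conn_mono_edges[of _ E' E] simp: E'_def)
        have "conn E (p z \<union> q (\<sigma> z))"
        proof (cases "z = x")
          case True
          then show ?thesis using conn_Un_edge[OF cp, of x y] pz qz e xy unfolding \<sigma>_def by simp
        next
          case False
          then have "z \<in> p z \<inter> q (\<sigma> z)" using pz qz by (simp add: \<sigma>_def)
          then show ?thesis by (intro conn_Un[OF cp]) blast
        qed
        then show "p z \<union> q (\<sigma> z) \<subseteq> V \<and> conn E (p z \<union> q (\<sigma> z)) \<and>
            (p z \<union> q (\<sigma> z)) \<inter> A \<noteq> {} \<and> (p z \<union> q (\<sigma> z)) \<inter> B \<noteq> {}"
          using pz qz V by auto
      next
        fix z z' assume z: "z \<in> insert x X" "z' \<in> insert x X" "z \<noteq> z'"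
        then show "(p z \<union> q (\<sigma> z)) \<inter> (p z' \<union> q (\<sigma> z')) = {}"
          using pdis[OF z] pq[OF z] pq[of z' z] qdis[OF \<sigma>[OF z(1)] \<sigma>[OF z(2)] \<sigma>inj[OF z]] by blast
      qed (use finX cX in auto)
    qed
  qed
qed

section \<open>Nonseparating links\<close>

text \<open>Choose a link \<open>Q\<close> and a connected set \<open>D\<close> around
  \<open>U\<close> disjoint from it, with \<open>D\<close> as large as possible. All neighbours of
  \<open>D\<close> then lie on \<open>Q\<close>. If a component \<open>K\<close> of the remaining
  vertices existed, it would have three attachments on \<open>Q\<close>. The link could be led
  through \<open>K\<close> using two of them, and the third could be added to \<open>D\<close>. So
  \<open>D\<close> is the whole complement of \<open>Q\<close>, and every vertex of \<open>Q\<close>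
  is adjacent to it.\<close>

lemma nonseparating_link:
  assumes finV: "finite V"
    and conn3: "\<And>X. \<lbrakk>X \<subseteq> V; card X < 3\<rbrakk> \<Longrightarrow> conn E (V - X)"
    and U: "conn E U" "U \<subseteq> V" "W \<subseteq> U"
    and P: "conn E P" "P \<subseteq> V" "P \<inter> U = {}" "a \<in> P" "b \<in> P"
      "\<And>p w. \<lbrakk>p \<in> P; w \<in> W\<rbrakk> \<Longrightarrow> {w,p} \<notin> E"
    and ab: "ua \<in> U" "{ua,a} \<in> E" "ub \<in> U" "{ub,b} \<in> E"
  obtains P' where "conn E P'" "P' \<subseteq> V" "P' \<inter> U = {}" "a \<in> P'" "b \<in> P'"
    "\<And>p w. \<lbrakk>p \<in> P'; w \<in> W\<rbrakk> \<Longrightarrow> {w,p} \<notin> E"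
    "conn E (V - P')" "\<And>p. p \<in> P' \<Longrightarrow> \<exists>v\<in>V - P'. {v,p} \<in> E"
proof -
  define valid where "valid = (\<lambda>(Q,D). conn E Q \<and> Q \<subseteq> V \<and> a \<in> Q \<and> b \<in> Q \<and>
    (\<forall>p\<in>Q. \<forall>w\<in>W. {w,p} \<notin> E) \<and> conn E D \<and> U \<subseteq> D \<and> D \<subseteq> V - Q)"
  have "valid (P,U)" unfolding valid_def using U P by auto
  moreover have "\<forall>QD. valid QD \<longrightarrow> card (snd QD) < Suc (card V)"
    unfolding valid_def using finV by (auto simp: less_Suc_eq_le intro!: card_mono)
  ultimately have "\<exists>QD. valid QD \<and> (\<forall>QD'. valid QD' \<longrightarrow> card (snd QD') \<le> card (snd QD))"
    by (rule Lattices_Big.ex_has_greatest_nat)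
  then obtain Q D where QD: "valid (Q,D)"
    and max: "\<And>Q' D'. valid (Q',D') \<Longrightarrow> card D' \<le> card D"
    by auto
  have Q: "conn E Q" "Q \<subseteq> V" "a \<in> Q" "b \<in> Q" "\<And>p w. \<lbrakk>p \<in> Q; w \<in> W\<rbrakk> \<Longrightarrow> {w,p} \<notin> E"
    and D: "conn E D" "U \<subseteq> D" "D \<subseteq> V - Q"
    using QD unfolding valid_def by auto
  have finD: "finite D" "finite Q" using D Q finV finite_subset by blast+
  \<comment> \<open>The maximality of \<open>D\<close> in usable form: no link may release a
    neighbour \<open>t\<close> of \<open>D\<close>.\<close>
  have extend: False if "d \<in> D" "t \<in> V" "t \<notin> D" "{d,t} \<in> E" "conn E Q'" "Q' \<subseteq> V" "a \<in> Q'" "b \<in> Q'"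
      "\<And>p w. \<lbrakk>p \<in> Q'; w \<in> W\<rbrakk> \<Longrightarrow> {w,p} \<notin> E" "t \<notin> Q'" "Q' \<inter> D = {}" for d t Q'
  proof -
    have "conn E (insert t D)" using conn_insert[OF D(1)] that by blast
    then have "valid (Q', insert t D)" unfolding valid_def using that D by auto
    then have "card (insert t D) \<le> card D" by (rule max)
    then show False using finD that by simp
  qed
  have Dcl: "t \<in> Q" if "d \<in> D" "t \<in> V" "t \<notin> D" "{d,t} \<in> E" for d t
    using extend[OF that Q] D by blast
  define N where "N = {t \<in> V - D. \<exists>d\<in>D. {d,t} \<in> E}"
  have NQ: "N \<subseteq> Q" using Dcl unfolding N_def by blast
  have "V \<subseteq> D \<union> N"
  proof (rule ccontr)
    assume "\<not> V \<subseteq> D \<union> N"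
    then obtain z where z: "z \<in> V - D - N" by blast
    then obtain K where K: "z \<in> K" "K \<subseteq> V - D - N" "conn E K"
      and Kcl: "\<And>x y. \<lbrakk>x \<in> K; y \<in> V - D - N; {x,y} \<in> E\<rbrakk> \<Longrightarrow> y \<in> K"
      using conn_component[of z "V - D - N" E] by metis
    have KD: "{d,u} \<notin> E" if "u \<in> K" "d \<in> D" for u d
      using that K unfolding N_def by blast
    define T where "T = {v \<in> V - K. \<exists>u\<in>K. {u,v} \<in> E}"
    have TN: "T \<subseteq> N"
    proof
      fix v assume "v \<in> T"
      then obtain u where u: "u \<in> K" "v \<in> V" "v \<notin> K" "{u,v} \<in> E" unfolding T_def by blast
      then have "v \<notin> D" using KD[of u v] by (auto simp: insert_commute)
      then show "v \<in> N" using Kcl[of u v] u by auto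
    qed
    have TQ: "T \<subseteq> Q" using TN NQ by (rule subset_trans)
    have TV: "T \<subseteq> V" using TQ Q(2) by (rule subset_trans)
    \<comment> \<open>Deleting \<open>T\<close> would cut \<open>K\<close> off from
      \<open>ua\<close>, which lies in \<open>D\<close>.\<close>
    have "\<not> card T < 3"
    proof
      assume "card T < 3"
      then have "conn E (V - T)" using conn3[OF TV] by simp
      then have "K = V - T"
      proof (rule conn_closedD)
        show "K \<subseteq> V - T" using K unfolding T_def by auto
        show "y \<in> K" if "x \<in> K" "y \<in> V - T" "{x,y} \<in> E" for x y
          using that unfolding T_def by auto
      qed (use K in auto)
      moreover have "ua \<in> V - T" "ua \<notin> K" using ab D K TQ by auto
      ultimately show False by blast
    qed
    then have "T \<noteq> {}" by auto
    have N: "a \<in> N" "b \<in> N" using ab D Q unfolding N_def by auto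
    have link: "\<exists>M x. M \<subseteq> Q \<and> conn E M \<and> c \<in> M \<and> M \<inter> T = {x}" if "c \<in> Q" for c
    proof -
      have "Q \<inter> {c} \<noteq> {}" "Q \<inter> T \<noteq> {}" using that TQ \<open>T \<noteq> {}\<close> by auto
      then obtain M c' x where "M \<subseteq> Q" "conn E M" "M \<inter> {c} = {c'}" "M \<inter> T = {x}"
        using conn_minimal_link[OF Q(1) finD(2)] by metis
      moreover from this have "c \<in> M" by auto
      ultimately show ?thesis by blast
    qed
    obtain Ma x where Ma: "Ma \<subseteq> Q" "conn E Ma" "a \<in> Ma" "Ma \<inter> T = {x}"
      using link[OF Q(3)] by blast
    obtain Mb y where Mb: "Mb \<subseteq> Q" "conn E Mb" "b \<in> Mb" "Mb \<inter> T = {y}"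
      using link[OF Q(4)] by blast
    \<comment> \<open>The detour enters \<open>K\<close> from \<open>a\<close> at \<open>x\<close>
      and leaves it towards \<open>b\<close> at \<open>y\<close>. A third attachment is
      released.\<close>
    have "\<not> T \<subseteq> {x,y}"
      using \<open>\<not> card T < 3\<close> card_mono[of "{x,y}" T] by (auto simp: card_insert_if split: if_splits)
    then obtain t where t: "t \<in> T" "t \<noteq> x" "t \<noteq> y" by blast
    have "x \<in> T" "y \<in> T" "x \<in> Ma" "y \<in> Mb" using Ma Mb by auto
    then obtain kx ky where k: "kx \<in> K" "{kx,x} \<in> E" "ky \<in> K" "{ky,y} \<in> E"
      unfolding T_def by blast
    have c1: "conn E (K \<union> Ma)" by (rule conn_Un_edge[OF K(3) Ma(2) k(1) \<open>x \<in> Ma\<close> k(2)])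
    have c2: "conn E ((K \<union> Ma) \<union> Mb)"
      by (rule conn_Un_edge[OF c1 Mb(2) _ \<open>y \<in> Mb\<close> k(4)]) (use k in simp)
    obtain d where d: "d \<in> D" "{d,t} \<in> E" "t \<in> V" "t \<notin> D" using t TN unfolding N_def by blast
    show False
    proof (rule extend[OF d(1) d(3) d(4) d(2) c2])
      show "K \<union> Ma \<union> Mb \<subseteq> V" "a \<in> K \<union> Ma \<union> Mb" "b \<in> K \<union> Ma \<union> Mb"
        using K Ma Mb Q by auto
      \<comment> \<open>The new vertices come from \<open>K\<close>, which has no neighbour in
        \<open>D\<close>, and \<open>D\<close> contains \<open>W\<close>.\<close>
      show "{w,p} \<notin> E" if "p \<in> K \<union> Ma \<union> Mb" "w \<in> W" for p w
        using that KD[of p w] Q(5)[of p w] Ma(1) Mb(1) U(3) D(2) by auto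
      show "t \<notin> K \<union> Ma \<union> Mb" using t Ma Mb unfolding T_def by auto
      show "(K \<union> Ma \<union> Mb) \<inter> D = {}" using K Ma Mb D by auto
    qed
  qed
  then have VQ: "D = V - Q" "Q = N" using D(3) NQ Q(2) by auto
  show ?thesis
  proof (rule that[OF Q(1,2) _ Q(3,4,5)])
    show "Q \<inter> U = {}" using D by auto
    show "conn E (V - Q)" using D VQ by simp
    show "\<exists>v\<in>V - Q. {v,p} \<in> E" if "p \<in> Q" for p
    proof -
      have "p \<in> N" using that VQ(2) by simp
      then show ?thesis unfolding N_def using VQ(1) by auto
    qed
  qed auto
qed

section \<open>Plane graphs\<close>

lemma connected_Un_closure:
  assumes "connected S" "connected T" "x \<in> closure S" "x \<in> T"
  shows "connected (S \<union> T)"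
proof -
  have "connected (insert x S)"
    by (rule connected_intermediate_closure[OF assms(1)]) (use assms closure_subset in auto)
  then have "connected (insert x S \<union> T)" using assms by (intro connected_Un) auto
  then show ?thesis using assms by (simp add: insert_absorb)
qed

lemma plane_graph_subset:
  assumes "plane_graph V A" "B \<subseteq> A"
  shows "plane_graph V B"
proof -
  have "a \<in> A" if "a \<in> B" for a using assms(2) that by (rule subsetD)
  with assms(1) finite_subset[OF assms(2)] show ?thesis unfolding plane_graph_def by simp
qed

text \<open>The drawing of the induced subgraph on \<open>W\<close>. It carries combinatorial
  connectedness over to the plane.\<close>

definition realize :: "complex set \<Rightarrow> complex set set \<Rightarrow> complex set \<Rightarrow> complex set"
  where "realize V A W = W \<union> \<Union>{a \<in> A. a \<inter> V \<subseteq> W}"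

lemma realize_mono: "W \<subseteq> W' \<Longrightarrow> realize V A W \<subseteq> realize V A W'"
  and edge_subset_realize: "\<lbrakk>a \<in> A; a \<inter> V \<subseteq> W\<rbrakk> \<Longrightarrow> a \<subseteq> realize V A W"
  unfolding realize_def by blast+

locale plane =
  fixes V :: "complex set" and A :: "complex set set"
  assumes plane: "plane_graph V A"
begin

lemma finite_vertices: "finite V" and finite_edges: "finite A"
  using plane unfolding plane_graph_def by auto

lemma plane_edges:
  shows "\<forall>a\<in>A. \<exists>g. arc g \<and> path_image g = a \<and> a \<inter> V = {pathstart g, pathfinish g}"
    and "\<forall>a\<in>A. \<forall>b\<in>A. a \<noteq> b \<longrightarrow> a \<inter> V \<noteq> b \<inter> V \<and> a \<inter> b \<subseteq> V"
  by (rule plane[unfolded plane_graph_def, THEN conjunct2, THEN conjunct2, THEN conjunct1],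
      rule plane[unfolded plane_graph_def, THEN conjunct2, THEN conjunct2, THEN conjunct2])

lemma edge_arc:
  assumes "a \<in> A"
  obtains g where "arc g" "path_image g = a" "a \<inter> V = {pathstart g, pathfinish g}"
  using bspec[OF plane_edges(1) assms] by (elim exE conjE) (rule that)

lemma edge_inj: "\<lbrakk>a \<in> A; b \<in> A; a \<inter> V = b \<inter> V\<rbrakk> \<Longrightarrow> a = b"
  and edge_Int: "\<lbrakk>a \<in> A; b \<in> A; a \<noteq> b\<rbrakk> \<Longrightarrow> a \<inter> b \<subseteq> V"
  using plane_edges(2) by metis+

lemma edge_Int_eq:
  assumes "a \<in> A" "b \<in> A" "a \<noteq> b"
  shows "a \<inter> b = (a \<inter> V) \<inter> (b \<inter> V)"
  using edge_Int[OF assms] by auto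

lemma edge_ends2:
  assumes "a \<in> A"
  obtains u v where "u \<noteq> v" "u \<in> V" "v \<in> V" "a \<inter> V = {u,v}"
proof -
  obtain g where g: "arc g" "path_image g = a" "a \<inter> V = {pathstart g, pathfinish g}"
    using edge_arc[OF assms] .
  then show ?thesis using that[of "pathstart g" "pathfinish g"] arc_distinct_ends[OF g(1)] by auto
qed

lemma edge_meets_vertices: "a \<in> A \<Longrightarrow> a \<inter> V \<noteq> {}"
  by (erule edge_ends2) simp

lemma edge_other_end:
  assumes "a \<in> A" "v \<in> a" "v \<in> V"
  obtains u where "u \<noteq> v" "u \<in> V" "a \<inter> V = {v,u}"
proof -
  obtain x y where xy: "x \<noteq> y" "x \<in> V" "y \<in> V" "a \<inter> V = {x,y}" using edge_ends2[OF assms(1)] .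
  have "v \<in> {x,y}" using assms xy(4) by blast
  then show ?thesis using that[of x] that[of y] xy by (cases "v = x") (auto simp: insert_commute)
qed

lemma edge_topology:
  assumes "a \<in> A"
  shows "compact a" "connected a" "connected (- a)" "connected (a - V)" "a - V \<noteq> {}"
    "a \<subseteq> closure (a - V)"
proof -
  obtain g where g: "arc g" "path_image g = a" "a \<inter> V = {pathstart g, pathfinish g}"
    using edge_arc[OF assms] .
  have aV: "a - V = path_image g - {pathstart g, pathfinish g}" using g by auto
  show "compact a" "connected a" using g by (auto simp: compact_arc_image connected_arc_image)
  show "connected (- a)" using connected_arc_complement[OF g(1)] g(2) by simp
  show "connected (a - V)" "a - V \<noteq> {}"
    unfolding aV
    using connected_simple_path_endless nonempty_simple_path_endless arc_imp_simple_path[OF g(1)]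
    by auto
  have ep: "a - V = g ` {0<..<1}"
    unfolding aV using simple_path_endless[OF arc_imp_simple_path[OF g(1)]] .
  have "g ` closure {0<..<1} \<subseteq> closure (g ` {0<..<1})"
    by (rule continuous_image_closure_subset[where A="{0..1}"])
      (use g(1) in \<open>auto simp: arc_def path_def\<close>)
  then show "a \<subseteq> closure (a - V)"
    unfolding ep using g(2) by (auto simp: path_image_def)
qed

lemma compact_Union_edges: "B \<subseteq> A \<Longrightarrow> compact (\<Union>B)"
  using finite_subset[OF _ finite_edges] edge_topology(1) by (intro compact_Union) (auto simp: subset_iff)

lemma closed_Union_edges: "B \<subseteq> A \<Longrightarrow> closed (\<Union>B)"
  by (intro compact_imp_closed compact_Union_edges)

lemma compact_realize: "W \<subseteq> V \<Longrightarrow> compact (realize V A W)"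
  unfolding realize_def
  by (intro compact_Un compact_Union_edges finite_imp_compact)
    (auto intro: finite_subset[OF _ finite_vertices])

lemma edge_of_ends:
  assumes "{u,v} \<in> edge_ends V A"
  obtains e where "e \<in> A" "e \<inter> V = {u,v}"
  using assms unfolding edge_ends_def by auto

text \<open>The full drawing of \<open>W\<close> may separate the plane, a tree does not. A vertex
  \<open>w\<close> whose removal keeps \<open>W\<close> connected is attached to a tree of the rest
  by one edge. That edge meets the tree in a single point, so by Janiszewski's theorem the union
  still does not separate.\<close>

lemma spanning_tree:
  assumes "finite W" "W \<subseteq> V" "W \<noteq> {}" "conn (edge_ends V A) W"
  shows "\<exists>T. compact T \<and> connected T \<and> connected (- T) \<and> W \<subseteq> T \<and> T \<subseteq> realize V A W"
  using assms
proof (induction "card W" arbitrary: W rule: less_induct)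
  case less
  obtain b where b: "b \<in> W" using less.prems by blast
  show ?case
  proof (cases "W = {b}")
    case True
    then show ?thesis
      by (intro exI[of _ "{b}"]) (auto simp: realize_def connected_punctured_universe)
  next
    case False
    obtain w where w: "w \<in> W" "w \<noteq> b" "conn (edge_ends V A) (W - {w})"
      using conn_delete_vertex[OF less.prems(4,1) b False] by metis
    have "\<not> (\<forall>x\<in>W-{w}. \<forall>y\<in>W. {x,y} \<in> edge_ends V A \<longrightarrow> y \<in> W - {w})"
    proof
      assume "\<forall>x\<in>W-{w}. \<forall>y\<in>W. {x,y} \<in> edge_ends V A \<longrightarrow> y \<in> W - {w}"
      then have "W - {w} = W" by (intro conn_closedD[OF less.prems(4)]) (use w b in auto)
      then show False using w by auto
    qed
    then obtain z where z: "z \<in> W" "z \<noteq> w" "{z,w} \<in> edge_ends V A" by blast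
    obtain e where e: "e \<in> A" "e \<inter> V = {z,w}" using edge_of_ends[OF z(3)] .
    have "card (W - {w}) < card W" using card_Diff1_less[OF less.prems(1) w(1)] .
    then obtain T where T: "compact T" "connected T" "connected (- T)" "W - {w} \<subseteq> T"
        "T \<subseteq> realize V A (W - {w})"
      using less.hyps[of "W - {w}"] less.prems w b by blast
    \<comment> \<open>An edge drawn in the old tree does not end in \<open>w\<close>, so it differs
      from \<open>e\<close> and can share only the vertex \<open>z\<close> with it.\<close>
    have eT: "T \<inter> e = {z}"
    proof
      show "{z} \<subseteq> T \<inter> e" using T(4) z e by auto
      show "T \<inter> e \<subseteq> {z}"
      proof
        fix x assume x: "x \<in> T \<inter> e"
        then consider "x \<in> W - {w}" | a where "a \<in> A" "a \<inter> V \<subseteq> W - {w}" "x \<in> a"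
          using T(5) unfolding realize_def by blast
        then show "x \<in> {z}"
        proof cases
          case 1 then show ?thesis using x e less.prems(2) by blast
        next
          case 2
          then have "a \<noteq> e" using e by auto
          then show ?thesis using 2 x edge_Int_eq[OF 2(1) e(1)] e by auto
        qed
      qed
    qed
    show ?thesis
    proof (intro exI conjI)
      show "compact (T \<union> e)" using T edge_topology[OF e(1)] by auto
      show "connected (T \<union> e)" by (rule connected_Un) (use T edge_topology[OF e(1)] eT in auto)
      show "connected (- (T \<union> e))"
        by (rule Janiszewski_connected)
          (use T edge_topology(3)[OF e(1)] compact_imp_closed[OF edge_topology(1)[OF e(1)]] eT in auto)
      show "W \<subseteq> T \<union> e" using T e by auto
      show "T \<union> e \<subseteq> realize V A W" 
      proof -
        have "e \<subseteq> realize V A W" by (rule edge_subset_realize[OF e(1)]) (use e(2) z w in simp)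
        moreover have "T \<subseteq> realize V A W" using T(5) realize_mono[of "W - {w}" W V A] by blast
        ultimately show ?thesis by simp
      qed
    qed
  qed
qed

lemma connected_realize:
  assumes "W \<subseteq> V" "conn (edge_ends V A) W"
  shows "connected (realize V A W)"
proof (cases "W = {}")
  case True
  have "\<not> a \<inter> V \<subseteq> {}" if "a \<in> A" for a using edge_meets_vertices[OF that] by auto
  then have e: "{a \<in> A. a \<inter> V \<subseteq> {}} = {}" by blast
  have "realize V A W = {}" unfolding realize_def True e by simp
  then show ?thesis by simp
next
  case False
  obtain T where T: "connected T" "W \<subseteq> T" "T \<subseteq> realize V A W"
    using spanning_tree[OF finite_subset[OF assms(1) finite_vertices] assms(1) False assms(2)] by blast
  obtain w where w: "w \<in> W" using False by blast
  have "\<exists>C\<subseteq>realize V A W. connected C \<and> w \<in> C \<and> x \<in> C" if x: "x \<in> realize V A W" for x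
  proof (cases "x \<in> W")
    case True then show ?thesis using T w by (intro exI[of _ T]) auto
  next
    case False
    then obtain a where a: "a \<in> A" "a \<inter> V \<subseteq> W" "x \<in> a" using x unfolding realize_def by blast
    obtain u where "u \<in> a" "u \<in> W" using edge_ends2[OF a(1)] a(2) by (metis IntD1 insertI1 subsetD)
    then have "connected (T \<union> a)" using T edge_topology(2)[OF a(1)] by (intro connected_Un) auto
    moreover have "T \<union> a \<subseteq> realize V A W" using T a unfolding realize_def by blast
    ultimately show ?thesis using T a w by (intro exI[of _ "T \<union> a"]) auto
  qed
  then have "realize V A W = \<Union>{C. C \<subseteq> realize V A W \<and> connected C \<and> w \<in> C}" by blast
  moreover have "connected (\<Union>{C. C \<subseteq> realize V A W \<and> connected C \<and> w \<in> C})"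
    by (rule connected_Union) auto
  ultimately show ?thesis by simp
qed

lemma realize_Int_edge:
  assumes "W \<subseteq> V" "b \<in> A" "b \<inter> W = {}"
  shows "realize V A W \<inter> b = {}"
proof -
  have "a \<inter> b = {}" if a: "a \<in> A" "a \<inter> V \<subseteq> W" for a
  proof -
    obtain u where "u \<in> b" "u \<in> V" using edge_meets_vertices[OF assms(2)] by blast
    then have "a \<noteq> b" using a(2) assms(3) by blast
    then have "a \<inter> b = (a \<inter> V) \<inter> (b \<inter> V)" by (rule edge_Int_eq[OF a(1) assms(2)])
    then show ?thesis using a(2) assms(3) by blast
  qed
  then show ?thesis using assms(3) unfolding realize_def by blast
qed

lemma realize_disjoint:
  assumes "P \<subseteq> V" "R \<subseteq> V" "P \<inter> R = {}"
  shows "realize V A P \<inter> realize V A R = {}"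
proof -
  have "realize V A P \<inter> b = {}" if b: "b \<in> A" "b \<inter> V \<subseteq> R" for b
  proof (rule realize_Int_edge[OF assms(1) b(1)])
    show "b \<inter> P = {}" using assms b(2) by blast
  qed
  moreover have "realize V A P \<inter> R = {}"
    using assms unfolding realize_def by blast
  ultimately show ?thesis unfolding realize_def[of V A R] by blast
qed

section \<open>Faces and crossing links\<close>

lemma face_facts:
  assumes "F \<in> faces V A"
  shows "connected F" "F \<noteq> {}" "F \<inter> V = {}" "F \<inter> \<Union>A = {}" "open F" "frontier F \<subseteq> V \<union> \<Union>A"
    "frontier F \<subseteq> closure F" "F \<inter> frontier F = {}"
proof -
  have cl: "closed (V \<union> \<Union>A)"
    by (intro closed_Un closed_Union_edges finite_imp_closed finite_vertices) auto
  have F: "F \<in> components (- (V \<union> \<Union>A))" using assms unfolding faces_def .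
  show "connected F" "F \<noteq> {}" using F in_components_connected in_components_nonempty by auto
  show "F \<inter> V = {}" "F \<inter> \<Union>A = {}" using in_components_subset[OF F] by auto
  show op: "open F" using open_components[OF open_Compl[OF cl] F] .
  show "frontier F \<subseteq> V \<union> \<Union>A" using frontier_of_components_closed_complement[OF cl F] .
  show "frontier F \<subseteq> closure F" by (auto simp: frontier_def)
  show "F \<inter> frontier F = {}" using op by (auto simp: frontier_def interior_open)
qed

lemma face_realize_disjoint:
  assumes "F \<in> faces V A" "P \<subseteq> V" shows "F \<inter> realize V A P = {}"
proof -
  have "realize V A P \<subseteq> V \<union> \<Union>A" using assms(2) unfolding realize_def by auto
  moreover have "F \<inter> (V \<union> \<Union>A) = {}" using face_facts(3,4)[OF assms(1)] by (simp add: Int_Un_distrib)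
  ultimately show ?thesis by auto
qed

lemma faces_disjoint:
  assumes "F \<in> faces V A" "F' \<in> faces V A" "F \<noteq> F'" shows "F \<inter> F' = {}"
  using assms components_nonoverlap[of F "- (V \<union> \<Union>A)" F'] unfolding faces_def by simp

text \<open>Two linkings from \<open>F\<close> to \<open>F'\<close> that start on different sides of the ends of \<open>R\<close>
  on the boundary of \<open>F\<close> cannot both avoid \<open>R\<close>: each of the two closed sets obtained by joining
  \<open>R\<close> with one part of that boundary fails to separate \<open>F\<close> from \<open>F'\<close>, hence by Janiszewski's
  theorem so does their union, which contains the boundary of \<open>F\<close>.\<close>

lemma no_crossing:
  assumes F: "F \<in> faces V A" "F' \<in> faces V A" "F \<noteq> F'"
    and R: "R \<subseteq> V" "conn (edge_ends V A) R"
    and B: "B1 \<subseteq> A" "B2 \<subseteq> A" "B1 \<inter> B2 = {}" "frontier F = \<Union>B1 \<union> \<Union>B2"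
      "V \<inter> \<Union>B1 \<inter> \<Union>B2 \<subseteq> R"
    and P1: "P1 \<subseteq> V" "conn (edge_ends V A) P1" "P1 \<inter> R = {}" "P1 \<inter> \<Union>B2 = {}"
      "P1 \<inter> frontier F \<noteq> {}" "P1 \<inter> frontier F' \<noteq> {}"
    and P2: "P2 \<subseteq> V" "conn (edge_ends V A) P2" "P2 \<inter> R = {}" "P2 \<inter> \<Union>B1 = {}"
      "P2 \<inter> frontier F \<noteq> {}" "P2 \<inter> frontier F' \<noteq> {}"
  shows False
proof -
  obtain f f' where f: "f \<in> F" "f' \<in> F'" using face_facts(2) F by blast
  \<comment> \<open>The two faces and the drawing of the link form a connected set, since the link
    touches both boundaries.\<close>
  have link: "connected_component (- (realize V A R \<union> \<Union>B)) f f'"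
    if P: "P \<subseteq> V" "conn (edge_ends V A) P" "P \<inter> R = {}" "P \<inter> \<Union>B = {}"
      "P \<inter> frontier F \<noteq> {}" "P \<inter> frontier F' \<noteq> {}" and BA: "B \<subseteq> A" for P B
  proof -
    let ?P = "realize V A P"
    have PP: "P \<subseteq> ?P" by (auto simp: realize_def)
    obtain p p' where p: "p \<in> P" "p \<in> closure F" "p' \<in> P" "p' \<in> closure F'"
      using P face_facts(7) F by blast
    have "connected (F \<union> ?P)"
      by (rule connected_Un_closure[OF face_facts(1)[OF F(1)] connected_realize[OF P(1,2)] p(2)])
        (use p PP in auto)
    then have "connected (F' \<union> (F \<union> ?P))"
      by (rule connected_Un_closure[OF face_facts(1)[OF F(2)] _ p(4)]) (use p PP in auto)
    moreover have "(F' \<union> (F \<union> ?P)) \<inter> (realize V A R \<union> \<Union>B) = {}"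
    proof -
      have "?P \<inter> realize V A R = {}" by (rule realize_disjoint) (use P R in auto)
      moreover have "?P \<inter> b = {}" if "b \<in> B" for b
      proof (rule realize_Int_edge[OF P(1)])
        show "b \<in> A" using BA that by auto
        show "b \<inter> P = {}" using P(4) that by auto
      qed
      moreover have "F \<inter> \<Union>B \<subseteq> F \<inter> \<Union>A" "F' \<inter> \<Union>B \<subseteq> F' \<inter> \<Union>A"
        by (intro Int_mono order_refl Union_mono BA)+
      then have "F \<inter> \<Union>B = {}" "F' \<inter> \<Union>B = {}"
        using face_facts(4)[OF F(1)] face_facts(4)[OF F(2)] by simp_all
      moreover have "F \<inter> realize V A R = {}" "F' \<inter> realize V A R = {}"
        using face_realize_disjoint F R by auto
      ultimately show ?thesis by auto
    qed
    ultimately show ?thesis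
      by (intro connected_componentI[of "F' \<union> (F \<union> ?P)"]) (use f in auto)
  qed
  let ?Z = "\<lambda>B. realize V A R \<union> \<Union>B"
  have "connected_component (- (?Z B2 \<union> ?Z B1)) f f'"
  proof (rule Janiszewski)
    show "compact (?Z B2)" "closed (?Z B1)"
      using compact_realize[OF R(1)] compact_Union_edges B by (auto intro: compact_imp_closed)
    \<comment> \<open>Edges of \<open>B1\<close> and \<open>B2\<close> meet only in vertices, and
      those vertices lie in \<open>R\<close>; so the intersection is the connected drawing of
      \<open>R\<close>.\<close>
    have "?Z B2 \<inter> ?Z B1 = realize V A R"
    proof -
      have "b2 \<inter> b1 \<subseteq> V" if "b2 \<in> B2" "b1 \<in> B1" for b1 b2
        using edge_Int[of b2 b1] B(1-3) that by blast
      then have "\<Union>B2 \<inter> \<Union>B1 \<subseteq> R" using B(5) by blast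
      moreover have "R \<subseteq> realize V A R" unfolding realize_def by simp
      ultimately show ?thesis by auto
    qed
    then show "connected (?Z B2 \<inter> ?Z B1)" using connected_realize R by simp
    show "connected_component (- ?Z B2) f f'" using link[OF P1 B(2)] .
    show "connected_component (- ?Z B1) f f'" using link[OF P2 B(1)] .
  qed
  then obtain C where C: "connected C" "C \<subseteq> - (?Z B2 \<union> ?Z B1)" "f \<in> C" "f' \<in> C"
    unfolding connected_component_def by (elim exE conjE) (rule that)
  then have "C \<inter> (?Z B2 \<union> ?Z B1) = {}" by (simp only: disjoint_eq_subset_Compl)
  then have "C \<inter> frontier F = {}" unfolding B(4) by (simp add: Int_Un_distrib)
  have "f' \<notin> F" using f faces_disjoint[OF F] by auto
  then show False using connected_Int_frontier[OF C(1), of F] \<open>C \<inter> frontier F = {}\<close> C(3,4) f by auto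
qed

end

section \<open>Two large faces\<close>

lemma conn_add_neighbours:
  assumes "conn E D" "\<And>p. p \<in> X \<Longrightarrow> \<exists>v\<in>D. {v,p} \<in> E"
  shows "conn E (D \<union> X)"
proof (cases "X = {}")
  case False
  then obtain u where u: "u \<in> D" using assms(2) by blast
  have "conn E (\<Union>((\<lambda>p. insert p D) ` X))"
  proof (rule conn_UnionI)
    fix C assume "C \<in> (\<lambda>p. insert p D) ` X"
    then obtain p where p: "p \<in> X" "C = insert p D" by auto
    obtain v where v: "v \<in> D" "{v,p} \<in> E" using assms(2)[OF p(1)] by auto
    show "conn E C" unfolding p(2) by (rule conn_insert[OF assms(1) v])
    show "u \<in> C" using p u by simp
  qed
  moreover have "(\<Union>((\<lambda>p. insert p D) ` X)) = D \<union> X" using False by auto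
  ultimately show ?thesis by simp
qed (use assms in simp)

lemma card_4_increasing:
  assumes "card (J :: nat set) = 4"
  obtains a b c d where "J = {a,b,c,d}" "a < b" "b < c" "c < d"
proof -
  have fin: "finite J" using assms by (metis card.infinite zero_neq_numeral)
  define l where "l = sorted_list_of_set J"
  have l: "length l = 4" "set l = J" "sorted_wrt (<) l"
    using fin assms by (auto simp: l_def)
  then obtain a b c d where "l = [a,b,c,d]"
    by (auto simp: numeral_eq_Suc length_Suc_conv)
  then show ?thesis using l by (intro that[of a b c d]) auto
qed

lemma minimal_cut_exists:
  assumes "finite S" "graph_cut V E S"
  obtains S' where "S' \<subseteq> S" "minimal_cut V E S'"
proof -
  have "\<exists>T. (T \<subseteq> S \<and> graph_cut V E T) \<and> (\<forall>T'. T' \<subseteq> S \<and> graph_cut V E T' \<longrightarrow> card T \<le> card T')"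
    by (rule ex_has_least_nat[of _ S]) (use assms in simp)
  then obtain T where T: "T \<subseteq> S" "graph_cut V E T"
    and min: "\<And>T'. \<lbrakk>T' \<subseteq> S; graph_cut V E T'\<rbrakk> \<Longrightarrow> card T \<le> card T'" by auto
  have "conn E (V - T')" if T': "T' \<subset> T" for T'
  proof (rule ccontr)
    assume "\<not> conn E (V - T')"
    then have "graph_cut V E T'" using T T' unfolding graph_cut_def by auto
    then have "card T \<le> card T'" using min[of T'] T T' by auto
    moreover have "card T' < card T"
      using T' T assms(1) by (meson psubset_card_mono finite_subset)
    ultimately show False by simp
  qed
  then show ?thesis using T that[of T] unfolding minimal_cut_def by simp
qed

lemma k_connectedD:
  "\<lbrakk>k_connected k V E; X \<subseteq> V; card X < k\<rbrakk> \<Longrightarrow> conn E (V - X)"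
  unfolding k_connected_def by simp

context plane begin

section \<open>Cycles and their segments\<close>

lemma cycle_facts:
  assumes "plane_cycle V A vs as"
  shows "3 \<le> length vs" "length as = length vs" "distinct vs" "set vs \<subseteq> V" "set as \<subseteq> A"
    "\<And>i. i < length vs \<Longrightarrow> as ! i \<in> A \<and> as ! i \<inter> V = {vs ! i, vs ! (Suc i mod length vs)}"
  using assms unfolding plane_cycle_def by auto

lemma cycle_edge:
  assumes "plane_cycle V A vs as" "i < length vs"
  shows "{vs ! i, vs ! (Suc i mod length vs)} \<in> edge_ends V A"
  using cycle_facts(6)[OF assms] unfolding edge_ends_def by (metis image_eqI)

lemma cycle_vertices:
  assumes cyc: "plane_cycle V A vs as"
  shows "V \<inter> \<Union>(set as) = set vs"
proof
  note c = cycle_facts[OF cyc]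
  have n: "0 < length vs" using c(1) by linarith
  show "V \<inter> \<Union>(set as) \<subseteq> set vs"
  proof
    fix x assume x: "x \<in> V \<inter> \<Union>(set as)"
    then obtain i where i: "i < length vs" "x \<in> as ! i" using c(2) by (auto simp: in_set_conv_nth)
    then have "x \<in> {vs ! i, vs ! (Suc i mod length vs)}" using c(6)[of i] x by blast
    then show "x \<in> set vs" using i n by auto
  qed
  show "set vs \<subseteq> V \<inter> \<Union>(set as)"
  proof
    fix x assume x: "x \<in> set vs"
    then obtain i where i: "i < length vs" "x = vs ! i" by (auto simp: in_set_conv_nth)
    then have "x \<in> as ! i" "as ! i \<in> set as" using c(6)[of i] c(2) by auto
    then show "x \<in> V \<inter> \<Union>(set as)" using c(4) x by auto
  qed
qed

lemma cycle_segment_conn: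
  assumes cyc: "plane_cycle V A vs as" "b \<le> length vs"
  shows "conn (edge_ends V A) ((!) vs ` {a..<b})"
  using assms(2)
proof (induction b)
  case (Suc b)
  show ?case
  proof (cases "a < b")
    case True
    have e: "{vs ! (b - 1), vs ! b} \<in> edge_ends V A"
      using cycle_edge[OF cyc(1), of "b - 1"] True Suc.prems by simp
    have "conn (edge_ends V A) (insert (vs ! b) ((!) vs ` {a..<b}))"
      by (rule conn_insert[OF _ _ e]) (use Suc True in auto)
    moreover have "{a..<Suc b} = insert b {a..<b}" using True by auto
    ultimately show ?thesis by simp
  next
    case False
    then have "{a..<Suc b} = {} \<or> {a..<Suc b} = {b}" by auto
    then show ?thesis by auto
  qed
qed simp

lemma cycle_delete_conn:
  assumes cyc: "plane_cycle V A vs as" and i: "i < length vs"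
  shows "conn (edge_ends V A) (set vs - {vs ! i})"
proof -
  note c = cycle_facts[OF cyc]
  let ?n = "length vs"
  let ?X = "(!) vs ` {Suc i..<?n}" and ?Y = "(!) vs ` {0..<i}"
  have "set vs = (!) vs ` {0..<?n}" by (auto simp: set_conv_nth)
  moreover have "{0..<?n} = {Suc i..<?n} \<union> {0..<i} \<union> {i}" using i by auto
  moreover have "vs ! i \<notin> ?X \<union> ?Y" using c(3) i by (auto simp: nth_eq_iff_index_eq)
  ultimately have eq: "set vs - {vs ! i} = ?X \<union> ?Y" by auto
  have X: "conn (edge_ends V A) ?X" and Y: "conn (edge_ends V A) ?Y"
    using cycle_segment_conn[OF cyc] i by simp_all
  show ?thesis
  proof (cases "Suc i < ?n \<and> 0 < i")
    case True
    have "{vs ! (?n - 1), vs ! 0} \<in> edge_ends V A"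
    proof -
      have "Suc (?n - 1) = ?n" using i by linarith
      moreover have "?n - 1 < ?n" using i by linarith
      ultimately show ?thesis using cycle_edge[OF cyc, of "?n - 1"] by simp
    qed
    then have "conn (edge_ends V A) (?X \<union> ?Y)"
      by (intro conn_Un_edge[OF X Y]) (use True in \<open>auto intro!: imageI\<close>)
    then show ?thesis unfolding eq .
  next
    case False
    then have "?X = {} \<or> ?Y = {}" by auto
    then show ?thesis unfolding eq using X Y by auto
  qed
qed

lemma cycle_neighbour:
  assumes cyc: "plane_cycle V A vs as" and x: "x \<in> set vs"
  obtains y where "y \<in> set vs" "y \<noteq> x" "{y,x} \<in> edge_ends V A"
proof -
  note c = cycle_facts[OF cyc]
  obtain i where i: "i < length vs" "x = vs ! i" using x by (auto simp: in_set_conv_nth)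
  have "Suc i mod length vs < length vs" "Suc i mod length vs \<noteq> i"
    using i c(1) by (auto simp: mod_Suc)
  then show ?thesis
    using cycle_edge[OF cyc i(1)] c(3) i
    by (intro that[of "vs ! (Suc i mod length vs)"]) (auto simp: nth_eq_iff_index_eq insert_commute)
qed

lemma cycle_split:
  assumes cyc: "plane_cycle V A vs as" and ac: "a < c" "c < length vs"
  obtains B1 B2 where "B1 \<subseteq> A" "B2 \<subseteq> A" "B1 \<inter> B2 = {}" "\<Union>(set as) = \<Union>B1 \<union> \<Union>B2"
    "V \<inter> \<Union>B1 \<subseteq> (!) vs ` {a..c}" "V \<inter> \<Union>B2 \<subseteq> (!) vs ` ({..a} \<union> {c..<length vs})"
proof -
  note c = cycle_facts[OF cyc]
  let ?n = "length vs"
  \<comment> \<open>The edge at index \<open>j\<close> joins positions \<open>j\<close> and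
    \<open>Suc j\<close>, so the half-open range of edges covers the closed range of vertices from
    \<open>a\<close> to \<open>c\<close>.\<close>
  define B1 where "B1 = (!) as ` {a..<c}"
  define B2 where "B2 = set as - B1"
  have s: "set as = (!) as ` {0..<?n}" using c(2) by (auto simp: set_conv_nth)
  have B1: "B1 \<subseteq> set as" unfolding s B1_def using ac by auto
  have v1: "V \<inter> \<Union>B1 \<subseteq> (!) vs ` {a..c}"
  proof
    fix x assume x: "x \<in> V \<inter> \<Union>B1"
    then obtain j where j: "a \<le> j" "j < c" "x \<in> as ! j" unfolding B1_def by auto
    then have "x \<in> {vs ! j, vs ! Suc j}" using c(6)[of j] ac x by auto
    then show "x \<in> (!) vs ` {a..c}" using j by auto
  qed
  have v2: "V \<inter> \<Union>B2 \<subseteq> (!) vs ` ({..a} \<union> {c..<?n})"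
  proof
    fix x assume x: "x \<in> V \<inter> \<Union>B2"
    then obtain j where j: "j < ?n" "as ! j \<notin> B1" "x \<in> as ! j"
      unfolding B2_def s by auto
    then have jac: "j < a \<or> c \<le> j" unfolding B1_def by (meson atLeastLessThan_iff image_eqI not_le)
    have "x \<in> {vs ! j, vs ! (Suc j mod ?n)}" using c(6)[OF j(1)] j(3) x by auto
    moreover have "j \<in> {..a} \<union> {c..<?n}" using j jac by auto
    \<comment> \<open>After the last index comes 0, which lies in \<open>{..a}\<close>.\<close>
    moreover have "Suc j mod ?n \<in> {..a} \<union> {c..<?n}" using j jac ac by (auto simp: mod_Suc)
    ultimately show "x \<in> (!) vs ` ({..a} \<union> {c..<?n})" by auto
  qed
  have "B1 \<subseteq> A" "B2 \<subseteq> A" using B1 c(5) unfolding B2_def by auto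
  moreover have "B1 \<inter> B2 = {}" "\<Union>(set as) = \<Union>B1 \<union> \<Union>B2" using B1 unfolding B2_def by auto
  ultimately show ?thesis using v1 v2 that by simp
qed

text \<open>The positions \<open>a\<close> and \<open>c\<close> cut the boundary into two segments
  that share only \<open>vs ! a\<close> and \<open>vs ! c\<close>, both in \<open>R\<close>. One
  segment contains the end of \<open>P1\<close>, the other that of \<open>P2\<close>, so
  \<open>no_crossing\<close> applies.\<close>

lemma no_crossing_cycle:
  assumes F: "F \<in> faces V A" "F' \<in> faces V A" "F \<noteq> F'"
    and cyc: "plane_cycle V A vs as" "frontier F = \<Union>(set as)"
    and abc: "a < b" "b < c" "c < length vs" and d: "d < length vs" "d < a \<or> c < d"
    and R: "R \<subseteq> V" "conn (edge_ends V A) R" "vs ! a \<in> R" "vs ! c \<in> R"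
    and P1: "P1 \<subseteq> V" "conn (edge_ends V A) P1" "P1 \<inter> R = {}" "P1 \<inter> set vs = {vs ! b}"
      "P1 \<inter> frontier F' \<noteq> {}"
    and P2: "P2 \<subseteq> V" "conn (edge_ends V A) P2" "P2 \<inter> R = {}" "P2 \<inter> set vs = {vs ! d}"
      "P2 \<inter> frontier F' \<noteq> {}"
  shows False
proof -
  note c = cycle_facts[OF cyc(1)]
  let ?n = "length vs"
  obtain B1 B2 where B: "B1 \<subseteq> A" "B2 \<subseteq> A" "B1 \<inter> B2 = {}" "\<Union>(set as) = \<Union>B1 \<union> \<Union>B2"
    "V \<inter> \<Union>B1 \<subseteq> (!) vs ` {a..c}" "V \<inter> \<Union>B2 \<subseteq> (!) vs ` ({..a} \<union> {c..<?n})"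
    using cycle_split[OF cyc(1) less_trans[OF abc(1,2)] abc(3)] .
  have inj: "i = j" if "vs ! i = vs ! j" "i < ?n" "j < ?n" for i j
    using nth_eq_iff_index_eq[OF c(3) that(2,3)] that(1) by simp
  have sub: "(!) vs ` {a..c} \<subseteq> set vs" "(!) vs ` ({..a} \<union> {c..<?n}) \<subseteq> set vs" using abc by auto
  have fv: "frontier F \<inter> V = set vs" using cycle_vertices[OF cyc(1)] cyc(2) by (simp add: Int_commute)
  show False
  proof (rule no_crossing[OF F R(1,2) B(1-3), of P1 P2])
    show "frontier F = \<Union>B1 \<union> \<Union>B2" using cyc(2) B(4) by simp
    show "V \<inter> \<Union>B1 \<inter> \<Union>B2 \<subseteq> R"
    proof
      fix x assume x: "x \<in> V \<inter> \<Union>B1 \<inter> \<Union>B2"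
      then obtain i where i: "x = vs ! i" "i \<in> {a..c}" using B(5) by auto
      have "x \<in> V \<inter> \<Union>B2" using x by simp
      then have "x \<in> (!) vs ` ({..a} \<union> {c..<?n})" using B(6) by (rule rev_subsetD)
      then obtain j where j: "x = vs ! j" "j \<in> {..a} \<union> {c..<?n}" by auto
      have "i = j" by (rule inj) (use i j abc in auto)
      then have "i = a \<or> i = c" using i j by auto
      then show "x \<in> R" using i R by auto
    qed
    show "P1 \<inter> \<Union>B2 = {}"
    proof (rule ccontr)
      assume "P1 \<inter> \<Union>B2 \<noteq> {}"
      then obtain x where x: "x \<in> P1" "x \<in> \<Union>B2" by auto
      then have "x \<in> V \<inter> \<Union>B2" using P1(1) by auto
      then have xs: "x \<in> (!) vs ` ({..a} \<union> {c..<?n})" using B(6) by (rule rev_subsetD)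
      then have "x \<in> set vs" using sub(2) by (rule rev_subsetD)
      then have "x = vs ! b" using P1(4) x(1) by auto
      moreover obtain j where "x = vs ! j" "j \<in> {..a} \<union> {c..<?n}" using xs by auto
      ultimately show False using inj[of b j] abc by auto
    qed
    show "P2 \<inter> \<Union>B1 = {}"
    proof (rule ccontr)
      assume "P2 \<inter> \<Union>B1 \<noteq> {}"
      then obtain x where x: "x \<in> P2" "x \<in> \<Union>B1" by auto
      then have "x \<in> V \<inter> \<Union>B1" using P2(1) by auto
      then have xs: "x \<in> (!) vs ` {a..c}" using B(5) by (rule rev_subsetD)
      then have "x \<in> set vs" using sub(1) by (rule rev_subsetD)
      then have "x = vs ! d" using P2(4) x(1) by auto
      moreover obtain j where "x = vs ! j" "j \<in> {a..c}" using xs by auto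
      ultimately show False using inj[of d j] abc d by auto
    qed
    show "P1 \<inter> frontier F \<noteq> {}" "P2 \<inter> frontier F \<noteq> {}" using fv P1(4) P2(4) by auto
  qed (use P1 P2 in simp_all)
qed

end

text \<open>Being connected, \<open>S\<close> cannot spread over both sides and lies in
  \<open>P\<close>. But no subset of \<open>P\<close> is a cut: the vertices of \<open>P\<close>
  that remain are all attached to the connected set \<open>V - P\<close>.\<close>

lemma minimal_cut_on_one_side:
  assumes "minimal_cut V E S" "conn E S" "S \<subseteq> P \<union> Q" "S \<inter> P \<noteq> {}"
    and PQ: "\<And>p q. \<lbrakk>p \<in> P; q \<in> Q\<rbrakk> \<Longrightarrow> {p,q} \<notin> E"
    and P: "P \<subseteq> V" "conn E (V - P)" "\<And>p. p \<in> P \<Longrightarrow> \<exists>v\<in>V - P. {v,p} \<in> E"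
  shows False
proof -
  have "S \<inter> P = S"
    by (rule conn_closedD[OF assms(2)]) (use assms(3,4) PQ in auto)
  then have SP: "S \<subseteq> P" by auto
  have "conn E ((V - P) \<union> (P - S))"
    by (rule conn_add_neighbours[OF P(2)]) (use P(3) in auto)
  moreover have "(V - P) \<union> (P - S) = V - S" using SP P(1) by auto
  ultimately show False using assms(1) unfolding minimal_cut_def graph_cut_def by simp
qed

section \<open>Cleavable graphs have at most one large face\<close>

context plane begin

lemma cleavable_large_face_unique:
  assumes k4: "k_connected 4 V (edge_ends V A)" and cleav: "cleavable V (edge_ends V A)"
    and large: "large_face V A F" "large_face V A F'"
  shows "F = F'"
proof (rule ccontr)
  assume neq: "F \<noteq> F'"
  let ?E = "edge_ends V A"
  have Ff: "F \<in> faces V A" and Ff': "F' \<in> faces V A" using large unfolding large_face_def by auto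
  obtain vs as where cyc: "plane_cycle V A vs as" "frontier F = \<Union>(set as)" "4 \<le> length as"
    using large(1) unfolding large_face_def by auto
  obtain vs' as' where cyc': "plane_cycle V A vs' as'" "frontier F' = \<Union>(set as')" "4 \<le> length as'"
    using large(2) unfolding large_face_def by auto
  note c = cycle_facts[OF cyc(1)] and c' = cycle_facts[OF cyc'(1)]
  let ?n = "length vs"
  have fv': "frontier F' \<inter> V = set vs'" using cycle_vertices[OF cyc'(1)] cyc'(2) by (simp add: Int_commute)
  have card4: "4 \<le> card (set vs)" "4 \<le> card (set vs')"
    using c(2,3) c'(2,3) cyc(3) cyc'(3) by (simp_all add: distinct_card)
  have inj: "i = j" if "vs ! i = vs ! j" "i < ?n" "j < ?n" for i j
    using nth_eq_iff_index_eq[OF c(3) that(2,3)] that(1) by simp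
  have "linked ?E V (set vs) (set vs') 4"
  proof (rule menger)
    show "finite ?E" unfolding edge_ends_def using finite_edges by simp
    show "\<exists>x y. e = {x,y} \<and> x \<noteq> y" if "e \<in> ?E" for e
    proof -
      obtain a where a: "a \<in> A" "e = a \<inter> V" using \<open>e \<in> ?E\<close> unfolding edge_ends_def by auto
      then show ?thesis using edge_ends2[OF a(1)] by metis
    qed
    fix X assume X: "X \<subseteq> V" "separates ?E V (set vs) (set vs') X"
    show "4 \<le> card X"
    proof (rule ccontr)
      assume "\<not> 4 \<le> card X"
      then have X4: "card X < 4" by simp
      then have "conn ?E (V - X)" using k_connectedD[OF k4 X(1)] by simp
      moreover have "\<not> Y \<subseteq> X" if "4 \<le> card Y" for Y
        using that card_mono[OF finite_subset[OF X(1) finite_vertices], of Y] X4 by linarith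
      then have "\<not> set vs \<subseteq> X" "\<not> set vs' \<subseteq> X" using card4 by auto
      then have "(V - X) \<inter> set vs \<noteq> {}" "(V - X) \<inter> set vs' \<noteq> {}" using c(4) c'(4) by auto
      ultimately have "(V - X) \<inter> X \<noteq> {}"
        using X(2)[unfolded separates_def, rule_format, of "V - X"] by simp
      then show False by auto
    qed
  qed (rule finite_vertices)
  then obtain f where f: "\<forall>i<4::nat. f i \<subseteq> V \<and> conn ?E (f i) \<and> f i \<inter> set vs \<noteq> {} \<and> f i \<inter> set vs' \<noteq> {}"
    and fdis: "\<forall>i<4. \<forall>j<4. i \<noteq> j \<longrightarrow> f i \<inter> f j = {}"
    unfolding linked_def by (elim exE conjE) (rule that)
  \<comment> \<open>Minimal links meet each boundary in one vertex only, so each has a definite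
    position on the boundary of \<open>F\<close>.\<close>
  have "\<exists>P k t. P \<subseteq> f i \<and> conn ?E P \<and> k < ?n \<and> P \<inter> set vs = {vs ! k} \<and> P \<inter> set vs' = {t}"
    if i: "i < 4" for i
  proof -
    have fi: "f i \<subseteq> V" "conn ?E (f i)" "f i \<inter> set vs \<noteq> {}" "f i \<inter> set vs' \<noteq> {}" using f i by simp_all
    obtain P s t where P: "P \<subseteq> f i" "conn ?E P" "P \<inter> set vs = {s}" "P \<inter> set vs' = {t}"
      using conn_minimal_link[OF fi(2) finite_subset[OF fi(1) finite_vertices] fi(3,4)] .
    have "s \<in> set vs" using P(3) by auto
    then obtain k where "k < ?n" "s = vs ! k" by (auto simp: in_set_conv_nth)
    then show ?thesis using P by auto
  qed
  then obtain P k t where P: "\<And>i. i < 4 \<Longrightarrow> P i \<subseteq> f i \<and> conn ?E (P i) \<and> k i < ?n \<and>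
      P i \<inter> set vs = {vs ! k i} \<and> P i \<inter> set vs' = {t i}"
    by metis
  have Pdis: "P i \<inter> P j = {}" if "i < 4" "j < 4" "i \<noteq> j" for i j
    using P[OF that(1)] P[OF that(2)] fdis that by blast
  have kinj: "inj_on k {..<4}"
  proof (rule inj_onI)
    fix i j assume ij: "i \<in> {..<4}" "j \<in> {..<4}" "k i = k j"
    then have "vs ! k i \<in> P i \<inter> P j" using P[of i] P[of j] by auto
    then show "i = j" using Pdis[of i j] ij by auto
  qed
  then have "card (k ` {..<4}) = 4" by (simp add: card_image)
  then obtain j1 j2 j3 j4 where j: "k ` {..<4} = {j1,j2,j3,j4}" "j1 < j2" "j2 < j3" "j3 < j4"
    by (rule card_4_increasing)
  have "\<exists>i<4. k i = x" if "x \<in> {j1,j2,j3,j4}" for x using that unfolding j(1)[symmetric] by auto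
  then obtain i1 i2 i3 i4 where i: "i1 < 4" "k i1 = j1" "i2 < 4" "k i2 = j2" "i3 < 4" "k i3 = j3"
      "i4 < 4" "k i4 = j4" by (metis insertCI)
  have jn: "j1 < ?n" "j2 < ?n" "j3 < ?n" "j4 < ?n" using P i by metis+
  define P1 P2 P3 P4 where "P1 = P i1" and "P2 = P i2" and "P3 = P i3" and "P4 = P i4"
  have PV: "P i \<subseteq> V" if "i < 4" for i using P[OF that] f that by blast
  have P1: "P1 \<subseteq> V" "conn ?E P1" "P1 \<inter> set vs = {vs ! j1}" "P1 \<inter> set vs' = {t i1}"
    and P2: "P2 \<subseteq> V" "conn ?E P2" "P2 \<inter> set vs = {vs ! j2}" "P2 \<inter> set vs' = {t i2}"
    and P3: "P3 \<subseteq> V" "conn ?E P3" "P3 \<inter> set vs = {vs ! j3}" "P3 \<inter> set vs' = {t i3}"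
    and P4: "P4 \<subseteq> V" "conn ?E P4" "P4 \<inter> set vs = {vs ! j4}" "P4 \<inter> set vs' = {t i4}"
    using P[OF i(1)] P[OF i(3)] P[OF i(5)] P[OF i(7)] PV i
    unfolding P1_def P2_def P3_def P4_def by simp_all
  have ine: "i1 \<noteq> i2" "i1 \<noteq> i3" "i1 \<noteq> i4" "i2 \<noteq> i3" "i2 \<noteq> i4" "i3 \<noteq> i4" using i j by auto
  have dis: "P2 \<inter> P1 = {}" "P2 \<inter> P3 = {}" "P4 \<inter> P1 = {}" "P4 \<inter> P3 = {}" "P1 \<inter> P3 = {}"
    unfolding P1_def P2_def P3_def P4_def using Pdis i ine by simp_all
  have toF': "Q \<inter> frontier F' \<noteq> {}" if "Q \<subseteq> V" "Q \<inter> set vs' = {x}" for Q x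
    using that fv' by auto
  \<comment> \<open>Otherwise \<open>P1 \<union> P3\<close> would be connected and would separate
    the starts of \<open>P2\<close> and \<open>P4\<close> on the boundary of \<open>F\<close>, and
    these links would have to cross it.\<close>
  have nonadj: "{p,q} \<notin> ?E" if pq: "p \<in> P1" "q \<in> P3" for p q
  proof
    assume "{p,q} \<in> ?E"
    then have con: "conn ?E (P1 \<union> P3)" by (rule conn_Un_edge[OF P1(2) P3(2) pq])
    show False
    proof (rule no_crossing_cycle[OF Ff Ff' neq cyc(1,2) j(2,3) jn(3,4) _ _ con])
      show "P2 \<inter> frontier F' \<noteq> {}" "P4 \<inter> frontier F' \<noteq> {}"
        using toF'[OF P2(1,4)] toF'[OF P4(1,4)] .
      show "P2 \<inter> set vs = {vs ! j2}" "P4 \<inter> set vs = {vs ! j4}" using P2 P4 by simp_all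
      show "vs ! j1 \<in> P1 \<union> P3" "vs ! j3 \<in> P1 \<union> P3" using P1(3) P3(3) by auto
      show "P2 \<inter> (P1 \<union> P3) = {}" "P4 \<inter> (P1 \<union> P3) = {}" using dis by auto
    qed (use P1 P2 P3 P4 j in auto)
  qed
  have conn3: "conn ?E (V - X)" if "X \<subseteq> V" "card X < 3" for X
    using k_connectedD[OF k4 that(1)] that(2) by simp
  \<comment> \<open>The obstacle set for rerouting a link: the opposite link together with both
    boundary cycles without the ends of the link to be rerouted. Avoiding it preserves the two ends
    and meets neither boundary elsewhere.\<close>
  have rest: "conn ?E (Q \<union> (set vs - {vs ! a}) \<union> (set vs' - {x}))"
      "Q \<union> (set vs - {vs ! a}) \<union> (set vs' - {x}) \<subseteq> V"
    if Q: "Q \<subseteq> V" "conn ?E Q" "Q \<inter> set vs = {vs ! b}" "Q \<inter> set vs' = {y}"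
      and ab: "a < ?n" "b < ?n" "a \<noteq> b" "x \<noteq> y" "x \<in> set vs'" for Q a b x y
  proof -
    have "vs ! b \<noteq> vs ! a" using inj[of a b] ab by auto
    then have "vs ! b \<in> Q \<inter> (set vs - {vs ! a})" using Q(3) by auto
    then have c1: "conn ?E (Q \<union> (set vs - {vs ! a}))"
      by (intro conn_Un[OF Q(2) cycle_delete_conn[OF cyc(1) ab(1)]]) auto
    obtain m where m: "m < length vs'" "x = vs' ! m" using ab(5) by (auto simp: in_set_conv_nth)
    have "y \<in> Q \<inter> (set vs' - {x})" using Q(4) ab(4) by auto
    then show "conn ?E (Q \<union> (set vs - {vs ! a}) \<union> (set vs' - {x}))"
      using cycle_delete_conn[OF cyc'(1) m(1)] unfolding m(2)[symmetric]
      by (intro conn_Un[OF c1]) auto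
    show "Q \<union> (set vs - {vs ! a}) \<union> (set vs' - {x}) \<subseteq> V" using Q c(4) c'(4) by auto
  qed
  have nonsep: "\<exists>Q'. Q' \<subseteq> V \<and> conn ?E Q' \<and> Q' \<inter> set vs = {vs ! a} \<and> Q' \<inter> set vs' = {x} \<and>
      Q' \<inter> W = {} \<and> (\<forall>p\<in>Q'. \<forall>w\<in>W. {w,p} \<notin> ?E) \<and> conn ?E (V - Q') \<and>
      (\<forall>p\<in>Q'. \<exists>v\<in>V - Q'. {v,p} \<in> ?E)"
    if W: "W \<subseteq> V" "conn ?E W" "W \<inter> set vs = {vs ! b}" "W \<inter> set vs' = {y}"
      and Q: "Q \<subseteq> V" "conn ?E Q" "Q \<inter> set vs = {vs ! a}" "Q \<inter> set vs' = {x}" "Q \<inter> W = {}"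
        "\<forall>p\<in>Q. \<forall>w\<in>W. {w,p} \<notin> ?E"
      and ab: "a < ?n" "b < ?n" "a \<noteq> b" for W Q a b x y
  proof -
    let ?U = "W \<union> (set vs - {vs ! a}) \<union> (set vs' - {x})"
    have x: "x \<in> set vs'" "x \<in> Q" "x \<notin> W" "vs ! a \<in> Q" using Q by auto
    have "y \<in> W" using W by auto
    then have "x \<noteq> y" using x by auto
    note U = rest[OF W ab \<open>x \<noteq> y\<close> x(1)]
    obtain ya where ya: "ya \<in> set vs" "ya \<noteq> vs ! a" "{ya, vs ! a} \<in> ?E"
      using cycle_neighbour[OF cyc(1), of "vs ! a"] ab by auto
    obtain yx where yx: "yx \<in> set vs'" "yx \<noteq> x" "{yx, x} \<in> ?E"
      using cycle_neighbour[OF cyc'(1) x(1)] by auto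
    have QU: "Q \<inter> ?U = {}" using Q(3-5) by auto
    have WU: "W \<subseteq> ?U" "ya \<in> ?U" "yx \<in> ?U" using ya(1,2) yx(1,2) by auto
    obtain Q' where Q': "conn ?E Q'" "Q' \<subseteq> V" "Q' \<inter> ?U = {}" "vs ! a \<in> Q'" "x \<in> Q'"
      "\<And>p w. \<lbrakk>p \<in> Q'; w \<in> W\<rbrakk> \<Longrightarrow> {w,p} \<notin> ?E"
      "conn ?E (V - Q')" "\<And>p. p \<in> Q' \<Longrightarrow> \<exists>v\<in>V - Q'. {v,p} \<in> ?E"
    proof (rule nonseparating_link[OF finite_vertices _ U(1,2) WU(1) Q(2,1) QU x(4,2) _
            WU(2) ya(3) WU(3) yx(3)])
      show "conn ?E (V - X)" if "X \<subseteq> V" "card X < 3" for X by (rule conn3[OF that])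
      show "{w,p} \<notin> ?E" if "p \<in> Q" "w \<in> W" for p w using Q(6) that by simp
    qed (rule that; assumption)
    have "vs ! a \<in> set vs" using ab(1) by simp
    then have "Q' \<inter> set vs = {vs ! a}" "Q' \<inter> set vs' = {x}" "Q' \<inter> W = {}"
      using Q'(3,4,5) x(1) by auto
    then show ?thesis using Q'(1,2,6,7,8) by (intro exI[of _ Q']) simp
  qed
  have j13: "j1 \<noteq> j3" "j3 \<noteq> j1" using j by auto
  have nonadj': "\<forall>p\<in>P1. \<forall>w\<in>P3. {w,p} \<notin> ?E"
    using nonadj by (simp add: insert_commute)
  have dis13: "P1 \<inter> P3 = {}" using dis by simp
  obtain Q1 where Q1: "Q1 \<subseteq> V" "conn ?E Q1" "Q1 \<inter> set vs = {vs ! j1}" "Q1 \<inter> set vs' = {t i1}"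
      "Q1 \<inter> P3 = {}" "\<forall>p\<in>Q1. \<forall>w\<in>P3. {w,p} \<notin> ?E" "conn ?E (V - Q1)"
      "\<forall>p\<in>Q1. \<exists>v\<in>V - Q1. {v,p} \<in> ?E"
    using nonsep[OF P3 P1 dis13 nonadj' jn(1,3) j13(1)] by (elim exE conjE) (rule that)
  have nonadj3: "\<forall>p\<in>P3. \<forall>w\<in>Q1. {w,p} \<notin> ?E"
  proof (intro ballI)
    fix p w assume "p \<in> P3" "w \<in> Q1"
    then have "{p,w} \<notin> ?E" using Q1(6) by simp
    then show "{w,p} \<notin> ?E" by (simp add: insert_commute)
  qed
  have dis31: "P3 \<inter> Q1 = {}" using Q1(5) by auto
  \<comment> \<open>The second link is rerouted against the new \<open>Q1\<close> instead of
    \<open>P1\<close>, so that the final pair is disjoint and not adjacent.\<close>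
  obtain Q3 where Q3: "Q3 \<subseteq> V" "conn ?E Q3" "Q3 \<inter> set vs = {vs ! j3}" "Q3 \<inter> set vs' = {t i3}"
      "Q3 \<inter> Q1 = {}" "\<forall>p\<in>Q3. \<forall>w\<in>Q1. {w,p} \<notin> ?E" "conn ?E (V - Q3)"
      "\<forall>p\<in>Q3. \<exists>v\<in>V - Q3. {v,p} \<in> ?E"
    using nonsep[OF Q1(1-4) P3 dis31 nonadj3 jn(3,1) j13(2)] by (elim exE conjE) (rule that)
  \<comment> \<open>The crossing argument with the roles exchanged: were the remaining graph
    connected, it would be the barrier through \<open>vs ! j2\<close> and \<open>vs ! j4\<close>,
    with \<open>Q3\<close> and \<open>Q1\<close> starting on different sides of it.\<close>
  have "\<not> conn ?E (V - (Q1 \<union> Q3))"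
  proof
    assume con: "conn ?E (V - (Q1 \<union> Q3))"
    show False
    proof (rule no_crossing_cycle[OF Ff Ff' neq cyc(1,2) j(3,4) jn(4,1) _ _ con])
      show "Q3 \<inter> frontier F' \<noteq> {}" "Q1 \<inter> frontier F' \<noteq> {}"
        using toF'[OF Q3(1,4)] toF'[OF Q1(1,4)] .
      \<comment> \<open>The rerouted links may run through \<open>P2\<close> and \<open>P4\<close>,
        but they meet the boundary of \<open>F\<close> only in their own ends.\<close>
      have "vs ! m \<in> V - (Q1 \<union> Q3)" if "m < ?n" "m \<noteq> j1" "m \<noteq> j3" for m
      proof -
        have "vs ! m \<in> set vs" using that by simp
        moreover have "vs ! m \<noteq> vs ! j1" "vs ! m \<noteq> vs ! j3" using inj that jn by auto
        ultimately show ?thesis using Q1(3) Q3(3) c(4) by blast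
      qed
      then show "vs ! j2 \<in> V - (Q1 \<union> Q3)" "vs ! j4 \<in> V - (Q1 \<union> Q3)" using jn j by auto
    qed (use Q1 Q3 j in auto)
  qed
  then have "graph_cut V ?E (Q1 \<union> Q3)" using Q1 Q3 unfolding graph_cut_def by auto
  moreover have "finite (Q1 \<union> Q3)" using Q1 Q3 finite_vertices finite_subset by auto
  ultimately obtain S where S: "S \<subseteq> Q1 \<union> Q3" "minimal_cut V ?E S"
    using minimal_cut_exists by metis
  have con: "conn ?E S" using cleav S(2) unfolding cleavable_def by auto
  have "conn ?E V" using k_connectedD[OF k4, of "{}"] by simp
  have "S \<noteq> {}"
  proof
    assume "S = {}"
    then show False using S(2) \<open>conn ?E V\<close> unfolding minimal_cut_def graph_cut_def by simp
  qed
  then consider "S \<inter> Q1 \<noteq> {}" | "S \<inter> Q3 \<noteq> {}" using S(1) by auto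
  then show False
  proof cases
    case 1
    show False
      by (rule minimal_cut_on_one_side[OF S(2) con S(1) 1 _ Q1(1,7)]) (use Q3(6) Q1(8) in auto)
  next
    case 2
    have S': "S \<subseteq> Q3 \<union> Q1" using S(1) by auto
    show False
      by (rule minimal_cut_on_one_side[OF S(2) con S' 2 _ Q3(1,7)])
        (use Q3(6,8) in \<open>auto simp: insert_commute\<close>)
  qed
qed

end

section \<open>Face boundaries are cycles\<close>

text \<open>\<open>S\<close> does not separate \<open>F\<close> from \<open>y\<close>, and neither
  does \<open>T\<close>, since \<open>F\<close> and \<open>C\<close> form a connected set off
  \<open>T\<close>. By Janiszewski's theorem \<open>y\<close> can be joined to \<open>F\<close> off
  \<open>S \<union> T\<close>, hence without meeting the frontier of \<open>F\<close>. In
  applications \<open>y\<close> lies on an edge, which is absurd.\<close>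

lemma frontier_extend:
  fixes F :: "complex set"
  assumes S: "compact S" "connected (- S)" and T: "closed T" "connected (S \<inter> T)"
    and F: "connected F" "F \<inter> (S \<union> T) = {}" "frontier F \<subseteq> S \<union> T"
    and x: "x \<in> closure F" and C: "connected C" "x \<in> C" "y \<in> C" "C \<inter> T = {}" and y: "y \<notin> S"
  shows "y \<in> F"
proof (rule ccontr)
  assume yF: "y \<notin> F"
  obtain z where z: "z \<in> F" using x by (metis closure_empty empty_iff equals0I)
  have "z \<notin> S" "F \<inter> T = {}" using F(2) z by auto
  have c1: "connected_component (- S) z y"
    by (rule connected_componentI[OF S(2)]) (use \<open>z \<notin> S\<close> y in auto)
  have "connected (F \<union> C)" by (rule connected_Un_closure[OF F(1) C(1) x C(2)])
  moreover have "F \<union> C \<subseteq> - T"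
    using \<open>F \<inter> T = {}\<close> C(4) by (simp add: disjoint_eq_subset_Compl)
  ultimately have c2: "connected_component (- T) z y"
    by (rule connected_componentI) (use z C(3) in auto)
  have "connected_component (- (S \<union> T)) z y" by (rule Janiszewski[OF S(1) T c1 c2])
  then obtain K where K: "connected K" "K \<subseteq> - (S \<union> T)" "z \<in> K" "y \<in> K"
    unfolding connected_component_def by (elim exE conjE) (rule that)
  have "K \<inter> frontier F \<noteq> {}" by (rule connected_Int_frontier[OF K(1)]) (use K z yF in auto)
  then show False using F(3) K(2) by (metis (no_types, lifting) Compl_iff disjoint_iff subset_iff)
qed

text \<open>The model is an edge at \<open>v\<close> on the boundary of the face \<open>F\<close>,
  with \<open>T\<close> a tree spanning the other vertices. Only the topological properties of the
  edge are kept, so that the theta graph argument needs no graph.\<close>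

definition spoke :: "complex set \<Rightarrow> complex set \<Rightarrow> complex \<Rightarrow> complex set \<Rightarrow> complex \<Rightarrow> bool"
  where "spoke F T v e u \<longleftrightarrow> compact e \<and> connected e \<and> connected (- e) \<and> e \<inter> T = {u} \<and> v \<in> e \<and>
    connected (e - {v,u}) \<and> (\<exists>x\<in>e - {v,u}. x \<in> closure F) \<and> F \<inter> e = {}"

text \<open>\<open>F\<close> touches the open spoke, so both lie in the same component of the
  complement of \<open>J\<close>, and that is not the component of \<open>w\<close>.\<close>

lemma spoke_component:
  assumes e3: "spoke F T v e3 u3" and J: "v \<in> J" "T \<subseteq> J" "J \<inter> e3 \<subseteq> {v,u3}"
    and F: "connected F" "F \<inter> J = {}" "z \<in> F"
    and w: "\<not> connected_component (- J) z w"
  shows "connected_component_set (- J) w \<inter> e3 = {}" "z \<notin> connected_component_set (- J) w"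
proof -
  show "z \<notin> connected_component_set (- J) w" using w by (simp add: connected_component_sym_eq)
  obtain x where x: "x \<in> e3 - {v,u3}" "x \<in> closure F" using e3 unfolding spoke_def by auto
  have con: "connected (F \<union> (e3 - {v,u3}))"
    by (rule connected_Un_closure[OF F(1) _ x(2,1)]) (use e3 in \<open>simp add: spoke_def\<close>)
  have sub: "F \<union> (e3 - {v,u3}) \<subseteq> - J" using J F by auto
  have "u3 \<in> J" using e3 J(2) unfolding spoke_def by auto
  show "connected_component_set (- J) w \<inter> e3 = {}"
  proof (rule ccontr)
    assume "connected_component_set (- J) w \<inter> e3 \<noteq> {}"
    then obtain y where y: "connected_component (- J) w y" "y \<in> e3" by auto
    then have "y \<notin> J" using connected_component_in by fastforce
    then have "y \<in> e3 - {v,u3}" using y J(1) \<open>u3 \<in> J\<close> by auto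
    then have "connected_component (- J) z y" 
      by (intro connected_componentI[OF con sub]) (use F in auto)
    then show False using w y(1) by (metis connected_component_sym connected_component_trans)
  qed
qed

text \<open>The component of \<open>w\<close> off the first pair of spokes avoids the third spoke,
  and the one off the second pair avoids the second spoke. So each is contained in the other. Their
  common frontier lies in \<open>e1 \<union> T\<close>, which does not separate the plane.\<close>

lemma theta_aux:
  assumes s1: "spoke F T v e1 u1" and s2: "spoke F T v e2 u2" and s3: "spoke F T v e3 u3"
    and T: "compact T" "connected T" "connected (- T)"
    and i: "e1 \<inter> e2 = {v}" "e1 \<inter> e3 = {v}" "e2 \<inter> e3 = {v}"
    and F: "connected F" "F \<inter> T = {}" "z \<in> F"
    and w: "w \<notin> e1 \<union> e2 \<union> e3 \<union> T"
    and w12: "\<not> connected_component (- (e1 \<union> e2 \<union> T)) z w"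
    and w13: "\<not> connected_component (- (e1 \<union> e3 \<union> T)) z w"
  shows False
proof -
  let ?J = "e1 \<union> e2 \<union> T" and ?K = "e1 \<union> e3 \<union> T"
  let ?W = "connected_component_set (- ?J) w" and ?X = "connected_component_set (- ?K) w"
  note S = s1[unfolded spoke_def] s2[unfolded spoke_def] s3[unfolded spoke_def]
  have ev: "v \<in> e1" "v \<in> e2" "v \<in> e3" using S by auto
  have eT: "e1 \<inter> T = {u1}" "e2 \<inter> T = {u2}" "e3 \<inter> T = {u3}" using S by auto
  have Fe: "F \<inter> e1 = {}" "F \<inter> e2 = {}" "F \<inter> e3 = {}" using S by auto
  have W: "?W \<inter> e3 = {}" "z \<notin> ?W"
    using spoke_component[OF s3 _ _ _ F(1) _ F(3) w12] ev eT i Fe F(2)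
    by (auto simp: Int_Un_distrib Int_Un_distrib2 Int_commute)
  have X: "?X \<inter> e2 = {}" 
    using spoke_component[OF s2 _ _ _ F(1) _ F(3) w13] ev eT i Fe F(2)
    by (auto simp: Int_Un_distrib Int_Un_distrib2 Int_commute)
  have WJ: "?W \<subseteq> - ?J" "?X \<subseteq> - ?K" by (rule connected_component_subset)+
  have wW: "w \<in> ?W" "w \<in> ?X" using w by simp_all
  have "?W \<subseteq> ?X"
    by (rule connected_component_maximal[OF wW(1) connected_connected_component]) (use WJ W(1) in auto)
  moreover have "?X \<subseteq> ?W"
    by (rule connected_component_maximal[OF wW(2) connected_connected_component]) (use WJ X in auto)
  ultimately have eq: "?W = ?X" by simp
  have cl: "closed ?J" "closed ?K"
    using S T(1) by (simp_all add: compact_Un compact_imp_closed)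
  have "frontier ?W \<subseteq> ?J"
    using frontier_of_connected_component_subset[of "- ?J" w] frontier_complement[of ?J]
      frontier_subset_closed[OF cl(1)] by simp
  moreover have "frontier ?X \<subseteq> ?K"
    using frontier_of_connected_component_subset[of "- ?K" w] frontier_complement[of ?K]
      frontier_subset_closed[OF cl(2)] by simp
  ultimately have "frontier ?W \<subseteq> ?J \<inter> ?K" using eq by simp
  moreover have "?J \<inter> ?K \<subseteq> e1 \<union> T" using i ev by auto
  ultimately have fr: "frontier ?W \<subseteq> e1 \<union> T" by (rule order_trans)
  have "connected (- (e1 \<union> T))"
    by (rule Janiszewski_connected) (use S T in \<open>auto simp: compact_imp_closed\<close>)
  then have "- (e1 \<union> T) \<inter> frontier ?W \<noteq> {}"
  proof (rule connected_Int_frontier)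
    show "- (e1 \<union> T) \<inter> ?W \<noteq> {}" using wW(1) w by auto
    show "- (e1 \<union> T) - ?W \<noteq> {}" using W(2) F(2,3) Fe(1) by auto
  qed
  then show False using fr by auto
qed

text \<open>No region disjoint from a theta graph has all three of its arcs on the boundary: of the
  three spokes at \<open>v\<close>, two together with \<open>T\<close> separate \<open>F\<close> from some point \<open>w\<close>,
  and by Janiszewski's theorem so does another pair; but then so would the common part of the
  two pairs, a spoke and \<open>T\<close>, which does not separate the plane.\<close>

lemma no_three_spokes:
  assumes s1: "spoke F T v e1 u1" and s2: "spoke F T v e2 u2" and s3: "spoke F T v e3 u3"
    and T: "compact T" "connected T" "connected (- T)"
    and i: "e1 \<inter> e2 = {v}" "e1 \<inter> e3 = {v}" "e2 \<inter> e3 = {v}"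
    and F: "connected F" "F \<inter> T = {}" "F \<noteq> {}" and u: "u1 \<noteq> u2"
  shows False
proof -
  obtain z where z: "z \<in> F" using F by auto
  note S = s1[unfolded spoke_def] s2[unfolded spoke_def] s3[unfolded spoke_def]
  have ev: "v \<in> e1" "v \<in> e2" "v \<in> e3" using S by auto
  have eT: "e1 \<inter> T = {u1}" "e2 \<inter> T = {u2}" "e3 \<inter> T = {u3}" using S by auto
  have Fe: "F \<inter> e1 = {}" "F \<inter> e2 = {}" "F \<inter> e3 = {}" using S by auto
  let ?J = "e1 \<union> e2 \<union> T"
  \<comment> \<open>Two spokes and \<open>T\<close> close up: they meet in the two points
    \<open>u1\<close> and \<open>u2\<close>, which the converse of Janiszewski's theorem excludes
    for a connected complement.\<close>
  have "\<not> connected (- ?J)"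
  proof
    assume "connected (- ?J)"
    moreover have "connected (e1 \<union> e2)" by (rule connected_Un) (use S i in auto)
    moreover have "compact (e1 \<union> e2)" using S by auto
    ultimately have "connected ((e1 \<union> e2) \<inter> T)" using T by (intro Janiszewski_dual) auto
    moreover have "(e1 \<union> e2) \<inter> T = {u1,u2}" using eT by auto
    ultimately have c: "connected {u1,u2}" by simp
    have "\<exists>a. {u1,u2} = {a}" using connected_finite_iff_sing[OF c] by simp
    then show False using u by auto
  qed
  then obtain w0 w1 where w01: "w0 \<in> - ?J" "w1 \<in> - ?J" "\<not> connected_component (- ?J) w0 w1"
    unfolding connected_iff_connected_component by auto
  have "\<not> connected_component (- ?J) z w0 \<or> \<not> connected_component (- ?J) z w1"
    using w01(3) by (metis connected_component_sym connected_component_trans)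
  then obtain w where w: "w \<notin> ?J" "\<not> connected_component (- ?J) z w" using w01 by auto
  have "connected_component_set (- ?J) w \<inter> e3 = {}"
    using spoke_component[OF s3 _ _ _ F(1) _ z w(2)] ev eT i Fe F(2)
    by (auto simp: Int_Un_distrib Int_Un_distrib2 Int_commute)
  moreover have "w \<in> connected_component_set (- ?J) w" using w by simp
  ultimately have "w \<notin> e3" by (meson disjoint_iff)
  then have w3: "w \<notin> e1 \<union> e2 \<union> e3 \<union> T" "w \<notin> e2 \<union> e1 \<union> e3 \<union> T" using w by auto
  let ?K1 = "e1 \<union> e3 \<union> T" and ?K2 = "e2 \<union> e3 \<union> T"
  have i': "e2 \<inter> e1 = {v}" using i by auto
  have "e2 \<union> e1 \<union> T = ?J" by auto
  then have w': "\<not> connected_component (- (e2 \<union> e1 \<union> T)) z w" using w by simp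
  have c1: "connected_component (- ?K1) z w"
    using theta_aux[OF s1 s2 s3 T i F(1,2) z w3(1) w(2)] by blast
  have c2: "connected_component (- ?K2) z w"
    using theta_aux[OF s2 s1 s3 T i' i(3,2) F(1,2) z w3(2) w'] by blast
  have "?K1 \<inter> ?K2 = e3 \<union> T" using i ev by auto
  moreover have "connected (e3 \<union> T)" by (rule connected_Un) (use S T in auto)
  ultimately have con: "connected (?K1 \<inter> ?K2)" by simp
  have cc: "compact ?K1" "compact ?K2" using S T by (auto intro!: compact_Un)
  have "connected_component (- (?K1 \<union> ?K2)) z w"
    by (rule Janiszewski[OF cc(1) compact_imp_closed[OF cc(2)] con c1 c2])
  then have "connected_component (- ?J) z w" by (rule connected_component_of_subset) auto
  then show False using w(2) by simp
qed

text \<open>If \<open>g t\<close> were off the frontier, so would be a short piece of the arc around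
  it. Cutting the arc there leaves two closed sets that contain the frontier and meet only in
  \<open>pathstart g\<close>. The segment from \<open>g s\<close> to \<open>g t\<close> avoids the
  second set, so \<open>frontier_extend\<close> would put \<open>g t\<close> into
  \<open>F\<close>.\<close>

lemma frontier_extend_arc:
  fixes F :: "complex set"
  assumes g: "arc g" and B: "closed B" "B \<inter> path_image g \<subseteq> {pathstart g, pathfinish g}"
    "pathstart g \<in> B"
    and F: "connected F" "F \<inter> (B \<union> path_image g) = {}" "frontier F \<subseteq> B \<union> path_image g"
    and st: "0 < s" "s < t" "t < 1" "g s \<in> frontier F"
  shows "g t \<in> frontier F"
proof (rule ccontr)
  assume gt: "g t \<notin> frontier F"
  have inj: "r = r'" if "g r = g r'" "r \<in> {0..1}" "r' \<in> {0..1}" for r r'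
    using g that unfolding arc_def by (meson inj_onD)
  have cont: "continuous_on {0..1} g" using g unfolding arc_def path_def by simp
  have img: "path_image g = g ` {0..1}" by (simp add: path_image_def)
  define K where "K = {0..1} \<inter> g -` frontier F"
  have "closed K" unfolding K_def by (rule continuous_closed_preimage[OF cont]) auto
  then have "open (- K)" by (rule open_Compl)
  moreover have "t \<in> - K" using gt unfolding K_def by auto
  ultimately obtain \<delta> where \<delta>: "0 < \<delta>" "cball t \<delta> \<subseteq> - K"
    unfolding open_contains_cball by auto
  \<comment> \<open>The halves keep the removed piece strictly between \<open>s\<close> and
    1.\<close>
  define \<epsilon> where "\<epsilon> = min \<delta> (min ((t - s) / 2) ((1 - t) / 2))"
  have \<epsilon>: "0 < \<epsilon>" "\<epsilon> \<le> \<delta>" "s < t - \<epsilon>" "t + \<epsilon> < 1"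
    using \<delta>(1) st unfolding \<epsilon>_def by (auto simp: min_def field_simps)
  have gap: "g r \<notin> frontier F" if "t - \<epsilon> \<le> r" "r \<le> t + \<epsilon>" for r
  proof -
    have "r \<in> cball t \<delta>" using that \<epsilon> by (auto simp: dist_real_def)
    moreover have "r \<in> {0..1}" using that \<epsilon> st by auto
    ultimately show ?thesis using \<delta>(2) unfolding K_def by auto
  qed
  let ?S = "path_image (subpath 0 (t - \<epsilon>) g)" and ?T = "B \<union> path_image (subpath (t + \<epsilon>) 1 g)"
  have sub: "?S = g ` {0..t-\<epsilon>}" "path_image (subpath (t + \<epsilon>) 1 g) = g ` {t+\<epsilon>..1}"
    using \<epsilon> st by (simp_all add: path_image_subpath)
  have arcS: "arc (subpath 0 (t - \<epsilon>) g)" using \<epsilon> st by (intro arc_subpath_arc[OF g]) auto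
  have arcT: "arc (subpath (t + \<epsilon>) 1 g)" using \<epsilon> st by (intro arc_subpath_arc[OF g]) auto
  have ends: "r = 0 \<or> r = 1" if "g r \<in> B" "r \<in> {0..1}" for r
  proof -
    have "g r \<in> {g 0, g 1}" using that B(2) img by (auto simp: pathstart_def pathfinish_def)
    then show ?thesis using inj[of r 0] inj[of r 1] that(2) by auto
  qed
  have "g t \<in> F"
  proof (rule frontier_extend[of ?S ?T F "g s" "g ` {s..t}"])
    show "compact ?S" using arcS by (rule compact_arc_image)
    show "connected (- ?S)" using connected_arc_complement[OF arcS] by simp
    show "closed ?T" 
      by (rule closed_Un[OF B(1) compact_imp_closed[OF compact_arc_image[OF arcT]]])
    have "?S \<inter> ?T = {g 0}"
    proof
      show "{g 0} \<subseteq> ?S \<inter> ?T" using B(3) \<epsilon> st unfolding sub by (auto simp: pathstart_def)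
      show "?S \<inter> ?T \<subseteq> {g 0}"
      proof
        fix y assume y: "y \<in> ?S \<inter> ?T"
        then have "y \<in> ?S" by simp
        then obtain r where r: "y = g r" "0 \<le> r" "r \<le> t - \<epsilon>" unfolding sub(1) by auto
        have r1: "r \<in> {0..1}" "r < 1" using r \<epsilon> st by auto
        have "\<not> (\<exists>r'\<in>{t+\<epsilon>..1}. g r = g r')"
        proof
          assume "\<exists>r'\<in>{t+\<epsilon>..1}. g r = g r'"
          then obtain r' where "r' \<in> {t+\<epsilon>..1}" "g r = g r'" by auto
          then show False using inj[of r r'] r r1 \<epsilon> st by auto
        qed
        then have "g r \<in> B" using y unfolding r(1) sub(2) by auto
        then show "y \<in> {g 0}" using ends[of r] r1 r(1) by auto
      qed
    qed
    then show "connected (?S \<inter> ?T)" by simp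
    have T: "?S \<subseteq> path_image g" "?T \<subseteq> B \<union> path_image g"
      unfolding sub img using \<epsilon> st by auto
    show "connected F" by (rule F(1))
    show "F \<inter> (?S \<union> ?T) = {}" using F(2) T by blast
    show "frontier F \<subseteq> ?S \<union> ?T"
    proof
      fix y assume y: "y \<in> frontier F"
      show "y \<in> ?S \<union> ?T"
      proof (cases "y \<in> B")
        case False
        then have "y \<in> g ` {0..1}" using F(3) y unfolding img by auto
        then obtain r where r: "y = g r" "r \<in> {0..1}" by auto
        then have "r < t - \<epsilon> \<or> t + \<epsilon> < r" using gap[of r] y r(1) by force
        then have "r \<in> {0..t-\<epsilon>} \<or> r \<in> {t+\<epsilon>..1}" using r(2) by auto
        then show ?thesis unfolding sub r(1) by auto
      qed simp
    qed
    show "g s \<in> closure F" using st(4) by (simp add: frontier_def)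
    show "connected (g ` {s..t})"
      by (rule connected_continuous_image[OF continuous_on_subset[OF cont]]) (use st in auto)
    show "g s \<in> g ` {s..t}" "g t \<in> g ` {s..t}" using st by auto
    show "g ` {s..t} \<inter> ?T = {}"
    proof (rule ccontr)
      assume "g ` {s..t} \<inter> ?T \<noteq> {}"
      then obtain y where "y \<in> g ` {s..t}" "y \<in> ?T" by (meson disjoint_iff)
      then obtain r where r: "r \<in> {s..t}" "g r \<in> ?T" by (metis imageE)
      have r1: "r \<in> {0..1}" "r \<noteq> 0" "r \<noteq> 1" using r st by auto
      then have "g r \<notin> B" using ends[of r] by auto
      then have "g r \<in> g ` {t+\<epsilon>..1}" using r(2) unfolding sub(2) by simp
      then obtain r' where r': "r' \<in> {t+\<epsilon>..1}" "g r = g r'" by auto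
      have "r = r'" by (rule inj[OF r'(2) r1(1)]) (use r'(1) \<epsilon> st in simp)
      then show False using r(1) r'(1) \<epsilon> by simp
    qed
    show "g t \<notin> ?S"
    proof
      assume "g t \<in> ?S"
      then have "g t \<in> g ` {0..t-\<epsilon>}" unfolding sub(1) .
      then obtain r where r: "r \<in> {0..t-\<epsilon>}" "g t = g r" by auto
      have "t = r" by (rule inj[OF r(2)]) (use r(1) \<epsilon> st in simp_all)
      then show False using r(1) \<epsilon> by simp
    qed
  qed
  moreover have "g t \<in> path_image g" unfolding img using st by auto
  ultimately show False using F(2) by auto
qed

context plane begin

text \<open>Frontier points propagate towards the end of an arc; reversing the arc gives the other
  direction, and closedness of the frontier adds the two ends.\<close>

lemma edge_in_frontier:
  assumes F: "F \<in> faces V A" and e: "e \<in> A" and x: "x \<in> e - V" "x \<in> frontier F"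
  shows "e \<subseteq> frontier F"
proof -
  obtain g where g: "arc g" "path_image g = e" "e \<inter> V = {pathstart g, pathfinish g}"
    using edge_arc[OF e] .
  have F': "connected F" "F \<inter> V = {}" "F \<inter> \<Union>A = {}" "frontier F \<subseteq> V \<union> \<Union>A"
    using face_facts[OF F] by auto
  let ?B = "V \<union> \<Union>(A - {e})"
  have un: "?B \<union> e = V \<union> \<Union>A" using e by auto
  have B: "closed ?B" by (intro closed_Un closed_Union_edges finite_imp_closed finite_vertices) auto
  have Be: "?B \<inter> e \<subseteq> {pathstart g, pathfinish g}"
  proof
    fix y assume y: "y \<in> ?B \<inter> e"
    then have "y \<in> V" using edge_Int[OF _ e] by auto
    then show "y \<in> {pathstart g, pathfinish g}" using g(3) y by auto
  qed
  have st: "pathstart g \<in> ?B" "pathfinish g \<in> ?B" using g(3) by auto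
  have FB: "F \<inter> (?B \<union> e) = {}" "frontier F \<subseteq> ?B \<union> e"
    unfolding un using F' by (simp_all add: Int_Un_distrib)
  have ep: "e - V = g ` {0<..<1}"
    using simple_path_endless[OF arc_imp_simple_path[OF g(1)]] g by auto
  have "e - V \<subseteq> frontier F"
  proof
    fix y assume y: "y \<in> e - V"
    obtain s where s: "0 < s" "s < 1" "x = g s" using x(1) unfolding ep by auto
    obtain t where t: "0 < t" "t < 1" "y = g t" using y unfolding ep by auto
    consider "s < t" | "s = t" | "t < s" by linarith
    then show "y \<in> frontier F"
    proof cases
      case 1
      show ?thesis unfolding t(3)
        by (rule frontier_extend_arc[of g ?B F s t]) (use g B Be st F' FB s t x 1 in auto)
    next
      case 2 then show ?thesis using s t x by simp
    next
      case 3
      let ?h = "reversepath g"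
      have h: "?h (1 - s) = g s" "?h (1 - t) = g t" by (simp_all add: reversepath_def)
      have "?h (1 - t) \<in> frontier F"
      proof (rule frontier_extend_arc[of ?h ?B F "1 - s" "1 - t"])
        show "?h (1 - s) \<in> frontier F" using h s x by simp
      qed (use g(1) B Be st F'(1) FB g(2) s t 3 in \<open>auto simp: arc_reversepath\<close>)
      then show ?thesis using h t by simp
    qed
  qed
  then have "closure (e - V) \<subseteq> frontier F" by (simp add: closure_minimal)
  then show ?thesis using edge_topology(6)[OF e] by (rule order_trans[rotated])
qed

end

section \<open>Boundary edges at a vertex of a 2-connected plane graph\<close>

locale plane_2_connected = plane +
  assumes two_connected: "k_connected 2 V (edge_ends V A)"
begin

lemma delete_vertex_conn: "v \<in> V \<Longrightarrow> conn (edge_ends V A) (V - {v})"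
  using two_connected[unfolded k_connected_def, THEN conjunct2, THEN conjunct2, rule_format, of "{v}"]
  by simp

lemma vertices_conn: "conn (edge_ends V A) V"
  using two_connected[unfolded k_connected_def, THEN conjunct2, THEN conjunct2, rule_format, of "{}"]
  by simp

lemma card_vertices: "card V > 2"
  using two_connected unfolding k_connected_def by (elim conjE)

lemma realize_all: "realize V A V = V \<union> \<Union>A"
  unfolding realize_def by auto

lemma frontier_connected: "F \<in> faces V A \<Longrightarrow> connected (frontier F)"
  using connected_realize[OF order_refl vertices_conn]
  unfolding realize_all faces_def by (rule connected_frontier_component_complement)

text \<open>If all edges at \<open>v\<close> led to a single vertex \<open>u\<close>, deleting
  \<open>u\<close> would isolate \<open>v\<close>, although a third vertex exists.\<close>

lemma edge_avoiding:
  assumes "v \<in> V"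
  obtains e where "e \<in> A" "v \<in> e" "e \<noteq> e0"
proof -
  have avoid: "\<exists>u\<in>V. u \<notin> X" if "card X \<le> 2" "finite X" for X
    using card_vertices card_mono[OF that(2), of V] that(1) by (meson leD le_trans subsetI)
  have "\<exists>u. u \<in> V \<and> u \<noteq> v \<and> (e0 \<in> A \<and> v \<in> e0 \<longrightarrow> e0 \<inter> V = {v,u})"
  proof (cases "e0 \<in> A \<and> v \<in> e0")
    case True
    obtain u where "u \<noteq> v" "u \<in> V" "e0 \<inter> V = {v,u}"
      using edge_other_end[OF conjunct1[OF True] conjunct2[OF True] assms] .
    then show ?thesis by auto
  next
    case False
    obtain w where "w \<in> V" "w \<notin> {v}" using avoid[of "{v}"] by auto
    then show ?thesis using False by auto
  qed
  then obtain u where u: "u \<in> V" "u \<noteq> v" and e0: "\<lbrakk>e0 \<in> A; v \<in> e0\<rbrakk> \<Longrightarrow> e0 \<inter> V = {v,u}" by auto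
  have "\<exists>x\<in>V - {u}. x \<noteq> v \<and> {v,x} \<in> edge_ends V A"
  proof (rule ccontr)
    assume no: "\<not> ?thesis"
    have "{v} = V - {u}"
      by (rule conn_closedD[OF delete_vertex_conn[OF u(1)]]) (use no assms u in auto)
    then have "V \<subseteq> {v,u}" by auto
    then show False using avoid[of "{v,u}"] u by auto
  qed
  then obtain x where x: "x \<in> V" "x \<noteq> u" "x \<noteq> v" "{v,x} \<in> edge_ends V A" by auto
  obtain e where e: "e \<in> A" "e \<inter> V = {v,x}" using edge_of_ends[OF x(4)] .
  have "v \<in> e" using e by auto
  moreover have "e \<noteq> e0"
  proof
    assume "e = e0"
    then have "{v,x} = {v,u}" using e0 e \<open>v \<in> e\<close> by auto
    then show False using x(2,3) by (auto simp: doubleton_eq_iff)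
  qed
  ultimately show ?thesis using that e(1) by simp
qed

text \<open>Suppose at most one boundary edge \<open>e0\<close> ends at \<open>v\<close>. It (or
  \<open>v\<close> alone) and the boundary away from \<open>v\<close> meet in at most one point.
  Another edge at \<open>v\<close>, which is not on the boundary, starts at a boundary point, so
  \<open>frontier_extend\<close> would put its interior into \<open>F\<close>.\<close>

lemma frontier_two_edges:
  assumes F: "F \<in> faces V A" and v: "v \<in> V" "v \<in> frontier F"
  obtains e1 e2 where "e1 \<in> A" "e2 \<in> A" "e1 \<noteq> e2" "v \<in> e1" "v \<in> e2"
    "e1 \<subseteq> frontier F" "e2 \<subseteq> frontier F"
proof (rule ccontr)
  assume not: "\<not> thesis"
  define Ev where "Ev = {e \<in> A. v \<in> e \<and> e \<subseteq> frontier F}"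
  have "\<exists>e0. Ev \<subseteq> {e0}"
  proof (cases "Ev = {}")
    case False
    then obtain e0 where "e0 \<in> Ev" by auto
    then have "Ev \<subseteq> {e0}" using not that unfolding Ev_def by blast
    then show ?thesis by auto
  qed auto
  then obtain e0 where e0: "Ev \<subseteq> {e0}" by auto
  have "\<exists>S u. compact S \<and> connected (- S) \<and> v \<in> S \<and> \<Union>Ev \<subseteq> S \<and> (\<forall>e\<in>A - Ev. (e - V) \<inter> S = {}) \<and>
      S \<inter> V \<subseteq> {v,u} \<and> F \<inter> S = {} \<and> (\<forall>e\<in>A - Ev. e \<inter> S \<subseteq> V)"
  proof (cases "Ev = {}")
    case True
    have "F \<inter> {v} = {}" using face_facts(3)[OF F] v by auto
    then show ?thesis unfolding True
      using v by (intro exI[of _ "{v}"] exI[of _ v]) (auto simp: connected_punctured_universe)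
  next
    case False
    then have Ev: "Ev = {e0}" using e0 by auto
    then have Ev': "e0 \<in> A" "v \<in> e0" unfolding Ev_def by auto
    obtain u where u: "e0 \<inter> V = {v,u}" using edge_other_end[OF Ev' v(1)] .
    have "e \<inter> e0 \<subseteq> V" if "e \<in> A - {e0}" for e using that edge_Int[of e e0] Ev'(1) by simp
    moreover have "F \<inter> e0 = {}" using face_facts(4)[OF F] Ev'(1) by auto
    ultimately show ?thesis unfolding Ev
      using edge_topology(1,3)[OF Ev'(1)] u Ev'(2) by (intro exI[of _ e0] exI[of _ u]) auto
  qed
  then obtain S u where S: "compact S" "connected (- S)" "v \<in> S" "\<Union>Ev \<subseteq> S"
    "\<And>e. e \<in> A - Ev \<Longrightarrow> (e - V) \<inter> S = {}" "S \<inter> V \<subseteq> {v,u}" "F \<inter> S = {}"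
    "\<And>e. e \<in> A - Ev \<Longrightarrow> e \<inter> S \<subseteq> V" by auto
  define T where "T = \<Union>{e \<in> A. e \<subseteq> frontier F \<and> v \<notin> e} \<union> (V \<inter> frontier F - {v})"
  have vT: "v \<notin> T" unfolding T_def by auto
  have Tf: "T \<subseteq> frontier F" unfolding T_def by auto
  have Tcases: "z \<in> V \<or> (\<exists>e'\<in>A - Ev. z \<in> e')" if "z \<in> T" for z
    using that unfolding T_def Ev_def by auto
  have clT: "closed T" unfolding T_def
    by (intro closed_Un closed_Union_edges finite_imp_closed)
      (auto intro: finite_subset[OF _ finite_vertices])
  obtain e where e: "e \<in> A" "v \<in> e" "e \<noteq> e0" using edge_avoiding[OF v(1)] .
  then have eEv: "e \<notin> Ev" using e0 by blast
  obtain y where y: "y \<in> e - V" using edge_topology(5)[OF e(1)] by auto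
  have enf: "(e - V) \<inter> frontier F = {}" using edge_in_frontier[OF F e(1)] e eEv unfolding Ev_def by auto
  have "y \<in> F"
  proof (rule frontier_extend[of S T F v "insert v (e - V)"])
    show "compact S" "connected (- S)" using S by simp_all
    show "closed T" by (rule clT)
    have "S \<inter> T \<subseteq> {u}"
    proof
      fix z assume z: "z \<in> S \<inter> T"
      have "z \<in> V" using Tcases[of z] S(8) z by auto
      then have "z \<in> {v,u}" using S(6) z by auto
      then show "z \<in> {u}" using z vT by auto
    qed
    then have "S \<inter> T = {} \<or> S \<inter> T = {u}" by (rule subset_singletonD)
    then show "connected (S \<inter> T)" by (metis connected_empty connected_sing)
    show "connected F" using face_facts(1)[OF F] .
    have "F \<inter> frontier F = {}" using face_facts(8)[OF F] .
    then have "F \<inter> T = {}" using Tf by auto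
    then show "F \<inter> (S \<union> T) = {}" using S(7) by (simp add: Int_Un_distrib)
    show "frontier F \<subseteq> S \<union> T"
    proof
      fix z assume z: "z \<in> frontier F"
      show "z \<in> S \<union> T"
      proof (cases "z \<in> V")
        case True then show ?thesis using z S(3) unfolding T_def by auto
      next
        case False
        then obtain e' where e': "e' \<in> A" "z \<in> e'" using face_facts(6)[OF F] z by auto
        then have "e' \<subseteq> frontier F" using edge_in_frontier[OF F] z False by auto
        then have "e' \<in> Ev \<or> e' \<subseteq> T" using e' unfolding Ev_def T_def by auto
        then show ?thesis using S(4) e'(2) by auto
      qed
    qed
    show "v \<in> closure F" using v(2) by (simp add: frontier_def)
    show "connected (insert v (e - V))"
      by (rule connected_intermediate_closure[OF edge_topology(4)[OF e(1)]])
        (use edge_topology(6)[OF e(1)] e(2) closure_subset in auto)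
    show "v \<in> insert v (e - V)" "y \<in> insert v (e - V)" using y by auto
    have "z \<notin> T" if "z \<in> e - V" for z
      using enf that Tf by auto
    then show "insert v (e - V) \<inter> T = {}" using vT by auto
    show "y \<notin> S" using S(5)[of e] e eEv y by auto
  qed
  then show False using face_facts(4)[OF F] e y by auto
qed

text \<open>Deleting \<open>v\<close> leaves a connected graph, whose spanning tree serves as
  \<open>T\<close>; the three edges become spokes.\<close>

lemma frontier_not_three_edges:
  assumes F: "F \<in> faces V A" and v: "v \<in> V"
    and e: "e1 \<in> A" "e2 \<in> A" "e3 \<in> A" "v \<in> e1" "v \<in> e2" "v \<in> e3"
      "e1 \<subseteq> frontier F" "e2 \<subseteq> frontier F" "e3 \<subseteq> frontier F"
    and ne: "e1 \<noteq> e2" "e1 \<noteq> e3" "e2 \<noteq> e3"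
  shows False
proof -
  let ?W = "V - {v}"
  have "?W \<noteq> {}" using card_vertices card_mono[of "{v}" V] by auto
  then obtain T where T: "compact T" "connected T" "connected (- T)" "?W \<subseteq> T" "T \<subseteq> realize V A ?W"
    using spanning_tree[of ?W] delete_vertex_conn[OF v] finite_vertices by auto
  have spoke: "\<exists>u. spoke F T v e u \<and> e \<inter> V = {v,u}" if e: "e \<in> A" "v \<in> e" "e \<subseteq> frontier F" for e
  proof -
    obtain u where u: "u \<noteq> v" "u \<in> V" "e \<inter> V = {v,u}" using edge_other_end[OF e(1,2) v] .
    have "e \<inter> T \<subseteq> {u}"
    proof
      fix x assume x: "x \<in> e \<inter> T"
      then have "x \<in> realize V A ?W" using T(5) by auto
      then consider "x \<in> ?W" | a where "a \<in> A" "a \<inter> V \<subseteq> ?W" "x \<in> a" unfolding realize_def by auto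
      then show "x \<in> {u}"
      proof cases
        case 1 then show ?thesis using x u by auto
      next
        case 2
        then have "a \<noteq> e" using e v by auto
        then have "x \<in> (a \<inter> V) \<inter> (e \<inter> V)" using edge_Int_eq[OF 2(1) e(1)] 2(3) x by auto
        then show ?thesis using 2(2) u(3) by auto
      qed
    qed
    moreover have "u \<in> e \<inter> T" using u T(4) by auto
    ultimately have eT: "e \<inter> T = {u}" by auto
    have eV: "e - {v,u} = e - V" using u(3) by auto
    obtain x where x: "x \<in> e - V" using edge_topology(5)[OF e(1)] by auto
    then have "x \<in> closure F" using e(3) face_facts(7)[OF F] by auto
    moreover have "F \<inter> e = {}" using face_facts(4)[OF F] e(1) by auto
    ultimately have "spoke F T v e u"
      unfolding spoke_def eV using edge_topology(1-4)[OF e(1)] eT e(2) x by (intro conjI) auto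
    then show ?thesis using u(3) by auto
  qed
  obtain u1 where u1: "spoke F T v e1 u1" "e1 \<inter> V = {v,u1}" using spoke e by metis
  obtain u2 where u2: "spoke F T v e2 u2" "e2 \<inter> V = {v,u2}" using spoke e by metis
  obtain u3 where u3: "spoke F T v e3 u3" "e3 \<inter> V = {v,u3}" using spoke e by metis
  have u: "u1 \<noteq> u2" "u1 \<noteq> u3" "u2 \<noteq> u3" using edge_inj u1 u2 u3 e ne by metis+
  have i: "a \<inter> b = {v}" if "a \<in> A" "b \<in> A" "a \<noteq> b" "a \<inter> V = {v,x}" "b \<inter> V = {v,y}" "x \<noteq> y" for a b x y
    using edge_Int_eq[OF that(1-3)] that(4-6) by auto
  show False
  proof (rule no_three_spokes[OF u1(1) u2(1) u3(1) T(1-3)])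
    show "e1 \<inter> e2 = {v}" by (rule i[OF e(1,2) ne(1) u1(2) u2(2) u(1)])
    show "e1 \<inter> e3 = {v}" by (rule i[OF e(1,3) ne(2) u1(2) u3(2) u(2)])
    show "e2 \<inter> e3 = {v}" by (rule i[OF e(2,3) ne(3) u2(2) u3(2) u(3)])
    show "F \<inter> T = {}" using face_realize_disjoint[OF F, of ?W] T(5) by auto
  qed (use face_facts[OF F] u in auto)
qed

text \<open>Every boundary vertex has exactly two boundary edges. A longest path along the boundary
  therefore closes up to a cycle, from which no further boundary edge can branch off. As the
  frontier is connected, the cycle is all of it.\<close>

theorem face_boundary_cycle:
  assumes F: "F \<in> faces V A"
  obtains vs as where "plane_cycle V A vs as" "frontier F = \<Union>(set as)"
proof -
  define B where "B = {e \<in> A. e \<subseteq> frontier F}"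
  define U where "U = V \<inter> frontier F"
  have BA: "B \<subseteq> A" unfolding B_def by auto
  have UV: "U \<subseteq> V" unfolding U_def by auto
  have finU: "finite U" using finite_subset[OF UV finite_vertices] .
  have frontier_eq: "frontier F = \<Union>B \<union> U"
  proof
    show "frontier F \<subseteq> \<Union>B \<union> U"
    proof
      fix z assume z: "z \<in> frontier F"
      show "z \<in> \<Union>B \<union> U"
      proof (cases "z \<in> V")
        case True then show ?thesis using z unfolding U_def by auto
      next
        case False
        then obtain e where e: "e \<in> A" "z \<in> e" using face_facts(6)[OF F] z by auto
        then have "e \<in> B" using edge_in_frontier[OF F] z False unfolding B_def by auto
        then show ?thesis using e by auto
      qed
    qed
  qed (auto simp: B_def U_def)
  have endsU: "e \<inter> V \<subseteq> U" if "e \<in> B" for e using that unfolding B_def U_def by auto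
  have deg2: False if "v \<in> V" "e1 \<in> B" "e2 \<in> B" "e3 \<in> B" "v \<in> e1" "v \<in> e2" "v \<in> e3"
      "e1 \<noteq> e2" "e1 \<noteq> e3" "e2 \<noteq> e3" for v e1 e2 e3
    using frontier_not_three_edges[OF F that(1), of e1 e2 e3] that unfolding B_def by auto
  have "frontier F \<noteq> {}"
  proof -
    have "V \<noteq> {}" using card_vertices by auto
    then have "F \<noteq> UNIV" using face_facts(3)[OF F] by auto
    then show ?thesis using face_facts(2)[OF F] by (simp add: frontier_eq_empty)
  qed
  then have "U \<noteq> {}" unfolding frontier_eq using edge_meets_vertices endsU BA by fastforce
  then obtain u0 where u0: "u0 \<in> U" by auto
  define path where "path = (\<lambda>vs. distinct vs \<and> set vs \<subseteq> U \<and> vs \<noteq> [] \<and>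
    (\<forall>i. Suc i < length vs \<longrightarrow> (\<exists>e\<in>B. e \<inter> V = {vs ! i, vs ! Suc i})))"
  have "path [u0]" unfolding path_def using u0 by auto
  moreover have "\<forall>vs. path vs \<longrightarrow> length vs < Suc (card U)"
  proof (intro allI impI)
    fix vs assume "path vs"
    then have "length vs = card (set vs)" "set vs \<subseteq> U" unfolding path_def by (auto simp: distinct_card)
    then show "length vs < Suc (card U)" using card_mono[OF finU, of "set vs"] by simp
  qed
  ultimately have "\<exists>vs. path vs \<and> (\<forall>ws. path ws \<longrightarrow> length ws \<le> length vs)"
    by (rule Lattices_Big.ex_has_greatest_nat)
  then obtain vs where vs: "path vs" and max: "\<And>ws. path ws \<Longrightarrow> length ws \<le> length vs" by auto
  let ?n = "length vs"
  let ?z = "vs ! (?n - 1)"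
  have dist: "distinct vs" and vsU: "set vs \<subseteq> U" and vs0: "?n > 0"
    and vsB: "\<And>i. Suc i < ?n \<Longrightarrow> \<exists>e\<in>B. e \<inter> V = {vs ! i, vs ! Suc i}"
    using vs unfolding path_def by auto
  have inj: "i = j" if "vs ! i = vs ! j" "i < ?n" "j < ?n" for i j
    using nth_eq_iff_index_eq[OF dist that(2,3)] that(1) by simp
  have zU: "?z \<in> U" "?z \<in> V" "?z \<in> frontier F" using vsU vs0 unfolding U_def by auto
  have returns: "\<exists>i. i < ?n \<and> e \<inter> V = {?z, vs ! i} \<and> vs ! i \<noteq> ?z"
    if e: "e \<in> B" "?z \<in> e" for e
  proof -
    have "e \<in> A" using e BA by auto
    then obtain a where a: "a \<noteq> ?z" "a \<in> V" "e \<inter> V = {?z,a}" using edge_other_end[OF _ e(2) zU(2)] by metis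
    have "a \<in> set vs"
    proof (rule ccontr)
      assume na: "a \<notin> set vs"
      have "path (vs @ [a])" unfolding path_def
      proof (intro conjI allI impI)
        show "distinct (vs @ [a])" using dist na by simp
        show "set (vs @ [a]) \<subseteq> U" using vsU endsU[OF e(1)] a by auto
        fix i assume i: "Suc i < length (vs @ [a])"
        show "\<exists>e\<in>B. e \<inter> V = {(vs @ [a]) ! i, (vs @ [a]) ! Suc i}"
        proof (cases "Suc i < ?n")
          case True then show ?thesis using vsB[of i] by (simp add: nth_append)
        next
          case False
          then have "i = ?n - 1" "Suc i = ?n" using i by auto
          then show ?thesis using e(1) a(3) vs0 by (auto simp: nth_append)
        qed
      qed simp
      then show False using max[of "vs @ [a]"] by simp
    qed
    then obtain i where "i < ?n" "vs ! i = a" by (auto simp: in_set_conv_nth)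
    then show ?thesis using a by auto
  qed
  obtain e1 e2 where e12: "e1 \<in> B" "e2 \<in> B" "e1 \<noteq> e2" "?z \<in> e1" "?z \<in> e2"
    using frontier_two_edges[OF F zU(2,3)] unfolding B_def by (metis (no_types, lifting) mem_Collect_eq)
  obtain i1 where i1: "i1 < ?n" "e1 \<inter> V = {?z, vs ! i1}" "vs ! i1 \<noteq> ?z" using returns[OF e12(1,4)] by auto
  obtain i2 where i2: "i2 < ?n" "e2 \<inter> V = {?z, vs ! i2}" "vs ! i2 \<noteq> ?z" using returns[OF e12(2,5)] by auto
  have i12: "i1 \<noteq> i2"
  proof
    assume "i1 = i2"
    then have "e1 \<inter> V = e2 \<inter> V" using i1 i2 by simp
    then show False using edge_inj e12 BA by auto
  qed
  \<comment> \<open>Both boundary edges at the last vertex lead back into the path. The one reaching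
    further back skips at least one path vertex, so it closes a cycle of length at least 3.\<close>
  have "\<exists>e i j. e \<in> B \<and> e \<inter> V = {?z, vs ! i} \<and> i < j \<and> j < ?n - 1"
  proof -
    have "i1 \<noteq> ?n - 1" "i2 \<noteq> ?n - 1" using i1(3) i2(3) by auto
    then have "i1 < ?n - 1" "i2 < ?n - 1" using i1(1) i2(1) by linarith+
    then show ?thesis using i1 i2 e12 i12 by (cases "i1 < i2") (metis, metis linorder_neqE_nat)
  qed
  then obtain e i j where e: "e \<in> B" "e \<inter> V = {?z, vs ! i}" and ij: "i < j" "j < ?n - 1" by auto
  have n3: "3 \<le> ?n" using ij by linarith
  \<comment> \<open>An inner path vertex already has two boundary edges on the path, and
    \<open>e\<close> would be a third.\<close>
  have "i = 0"
  proof (rule ccontr)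
    assume "i \<noteq> 0"
    then have si: "Suc (i - 1) = i" "Suc (i - 1) < ?n" "Suc i < ?n" using ij by linarith+
    obtain a where a: "a \<in> B" "a \<inter> V = {vs ! (i - 1), vs ! i}" using vsB[OF si(2)] si(1) by auto
    obtain b where b: "b \<in> B" "b \<inter> V = {vs ! i, vs ! Suc i}" using vsB[OF si(3)] by auto
    have "vs ! i \<in> set vs" using si by simp
    then have v: "vs ! i \<in> V" using vsU UV by auto
    have ne: "vs ! (i - 1) \<noteq> vs ! i" "vs ! i \<noteq> vs ! Suc i" "vs ! (i - 1) \<noteq> vs ! Suc i"
      "?z \<noteq> vs ! i" "?z \<noteq> vs ! Suc i" "?z \<noteq> vs ! (i - 1)"
    proof -
      have lt: "i - 1 < ?n" "i < ?n" "Suc i < ?n" "?n - 1 < ?n" using ij by linarith+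
      have "i - 1 \<noteq> i" "i \<noteq> Suc i" "i - 1 \<noteq> Suc i" "?n - 1 \<noteq> i" "?n - 1 \<noteq> Suc i" "?n - 1 \<noteq> i - 1"
        using ij si by linarith+
      then show "vs ! (i - 1) \<noteq> vs ! i" "vs ! i \<noteq> vs ! Suc i" "vs ! (i - 1) \<noteq> vs ! Suc i"
        "?z \<noteq> vs ! i" "?z \<noteq> vs ! Suc i" "?z \<noteq> vs ! (i - 1)"
        using nth_eq_iff_index_eq[OF dist] lt by metis+
    qed
    have "a \<noteq> b" "a \<noteq> e" "b \<noteq> e" using a(2) b(2) e(2) ne by (auto simp: doubleton_eq_iff)
    moreover have "vs ! i \<in> a" "vs ! i \<in> b" "vs ! i \<in> e" using a(2) b(2) e(2) by auto
    ultimately show False using deg2[OF v a(1) b(1) e(1)] by simp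
  qed
  then have e: "e \<in> B" "e \<inter> V = {?z, vs ! 0}" using e by simp_all
  have edge: "\<exists>e\<in>B. e \<inter> V = {vs ! k, vs ! (Suc k mod ?n)}" if "k < ?n" for k
  proof (cases "Suc k < ?n")
    case True then show ?thesis using vsB[OF True] by simp
  next
    case False
    then have "k = ?n - 1" "Suc k mod ?n = 0" using that by (auto simp: le_less_Suc_eq not_less_eq)
    then show ?thesis using e by auto
  qed
  define E where "E = (\<lambda>k. SOME e. e \<in> B \<and> e \<inter> V = {vs ! k, vs ! (Suc k mod ?n)})"
  have E: "E k \<in> B" "E k \<inter> V = {vs ! k, vs ! (Suc k mod ?n)}" if "k < ?n" for k
    using someI_ex[of "\<lambda>e. e \<in> B \<and> e \<inter> V = {vs ! k, vs ! (Suc k mod ?n)}"] edge[OF that]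
    unfolding E_def by auto
  define as where "as = map E [0..<?n]"
  have as: "length as = ?n" "\<And>k. k < ?n \<Longrightarrow> as ! k = E k" "set as = E ` {..<?n}"
    unfolding as_def by (auto simp: atLeast0LessThan)
  have asB: "set as \<subseteq> B" using E as by auto
  have cyc: "plane_cycle V A vs as"
    unfolding plane_cycle_def using n3 as(1,2) dist vsU UV asB BA E(2) by auto
  define D where "D = \<Union>(B - set as) \<union> (U - set vs)"
  have closed: "closed (\<Union>(set as))" "closed D"
    unfolding D_def
    by (intro closed_Un closed_Union_edges finite_imp_closed finite_Diff finU; use asB BA in auto)+
  have un: "frontier F \<subseteq> \<Union>(set as) \<union> D" unfolding frontier_eq D_def using asB cycle_vertices[OF cyc] by auto
  \<comment> \<open>A leftover boundary edge touching the cycle would meet it in a vertex, as the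
    third boundary edge there.\<close>
  have "\<Union>(set as) \<inter> D = {}"
  proof (rule ccontr)
    assume "\<Union>(set as) \<inter> D \<noteq> {}"
    then obtain y where y: "y \<in> \<Union>(set as)" "y \<in> D" by auto
    have "\<exists>b\<in>B - set as. y \<in> b"
    proof (rule ccontr)
      assume "\<not> ?thesis"
      then have "y \<in> U" "y \<notin> set vs" using y(2) unfolding D_def by auto
      then show False using cycle_vertices[OF cyc] y(1) UV by auto
    qed
    then obtain b where b: "b \<in> B" "b \<notin> set as" "y \<in> b" by auto
    obtain a where a: "a \<in> set as" "y \<in> a" using y(1) by auto
    have "a \<noteq> b" using a b by auto
    then have "y \<in> V" using edge_Int[of a b] a b asB BA by auto
    then have "y \<in> set vs" using cycle_vertices[OF cyc] y(1) by auto
    then obtain k where k: "k < ?n" "y = vs ! k" by (auto simp: in_set_conv_nth)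
    define p where "p = (if k = 0 then ?n - 1 else k - 1)"
    have p: "p < ?n" "Suc p mod ?n = k" "p \<noteq> k" "Suc k mod ?n < ?n" "Suc k mod ?n \<noteq> p" "Suc k mod ?n \<noteq> k"
      using k n3 unfolding p_def by (auto simp: mod_Suc)
    have ne: "E k \<noteq> E p"
    proof
      assume "E k = E p"
      then have "{vs ! k, vs ! (Suc k mod ?n)} = {vs ! p, vs ! k}"
        using E(2)[OF k(1)] E(2)[OF p(1)] p(2) by simp
      then have "vs ! (Suc k mod ?n) = vs ! p \<or> vs ! k = vs ! p" by (auto simp: doubleton_eq_iff)
      then show False using inj[OF _ p(4,1)] inj[OF _ k(1) p(1)] p by auto
    qed
    have "E k \<in> set as" "E p \<in> set as" using as(3) k p by auto
    moreover have "y \<in> E k" "y \<in> E p" using E(2)[OF k(1)] E(2)[OF p(1)] p(2) k(2) by auto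
    ultimately show False
      using deg2[OF \<open>y \<in> V\<close> E(1)[OF k(1)] E(1)[OF p(1)] b(1)] ne b by auto
  qed
  then have disj: "\<Union>(set as) \<inter> D \<inter> frontier F = {}" by auto
  have "vs ! 0 \<in> \<Union>(set as) \<inter> frontier F"
    using cycle_vertices[OF cyc] vs0 vsU nth_mem[of 0 vs] unfolding U_def by auto
  then have "D \<inter> frontier F = {}"
    using connected_closedD[OF frontier_connected[OF F] disj un closed] by auto
  then have "frontier F \<subseteq> \<Union>(set as)" using un by auto
  moreover have "\<Union>(set as) \<subseteq> frontier F" using asB unfolding B_def by auto
  ultimately show ?thesis using that cyc by auto
qed

end

section \<open>At most one large face\<close>

text \<open>An inversion about a point \<open>z\<close> outside both sets makes an unbounded
  \<open>T\<close> compact once 0, the image of infinity, is added. If no such point exists,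
  unicoherence of the plane gives the claim.\<close>

lemma Janiszewski_dual_closed:
  fixes S T :: "complex set"
  assumes S: "compact S" "connected S" and T: "closed T" "connected T"
    and con: "connected (- (S \<union> T))"
  shows "connected (S \<inter> T)"
proof (cases "bounded T \<or> - (S \<union> T) = {}")
  case True
  then show ?thesis
  proof
    assume "bounded T"
    then show ?thesis using Janiszewski_dual S T con compact_eq_bounded_closed by blast
  next
    assume "- (S \<union> T) = {}"
    then have un: "UNIV = S \<union> T" by auto
    have "closedin (top_of_set UNIV) S" "closedin (top_of_set UNIV) T"
      using compact_imp_closed[OF S(1)] T(1) by simp_all
    then show ?thesis by (rule unicoherentD[OF unicoherent_UNIV S(2) T(2) un])
  qed
next
  case False
  then obtain z where z: "z \<in> - (S \<union> T)" by auto
  \<comment> \<open>By the convention \<open>inverse 0 = 0\<close> the maps \<open>i\<close> and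
    \<open>j\<close> are mutually inverse on the whole plane, with \<open>i z = 0\<close>. So the
    identities between them hold without side conditions.\<close>
  define i where "i = (\<lambda>x::complex. inverse (x - z))"
  define j where "j = (\<lambda>w::complex. z + inverse w)"
  have ji: "j (i x) = x" for x unfolding i_def j_def by simp
  have ij: "i (j w) = w" for w unfolding i_def j_def by simp
  have i0: "i x = 0 \<longleftrightarrow> x = z" for x unfolding i_def by simp
  have mem: "w \<in> i ` X \<longleftrightarrow> j w \<in> X" for w X by (metis ij ji imageE image_eqI)
  have conti: "continuous_on X i" if "z \<notin> X" for X
    unfolding i_def using that by (intro continuous_intros) auto
  have contj: "continuous_on X j" if "0 \<notin> X" for X
    unfolding j_def using that by (intro continuous_intros) auto
  have zST: "z \<notin> S" "z \<notin> T" using z by auto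
  let ?S = "i ` S" and ?T = "insert 0 (i ` T)"
  have clT: "closed ?T"
  proof -
    have "- ?T = (- {0}) \<inter> j -` (- T)" using mem by auto
    moreover have "open ((- {0}) \<inter> j -` (- T))"
      by (rule continuous_open_preimage[OF contj]) (use T in auto)
    ultimately show ?thesis by (simp add: closed_def)
  qed
  obtain \<epsilon> where \<epsilon>: "\<epsilon> > 0" "ball z \<epsilon> \<subseteq> - T"
    using T(1) zST(2) open_contains_ball[of "- T"] by auto
  have "norm w \<le> inverse \<epsilon>" if wT: "w \<in> ?T" for w
  proof (cases "w = 0")
    case True then show ?thesis using \<epsilon>(1) by simp
  next
    case False
    then obtain x where x: "x \<in> T" "w = i x" using wT by auto
    then have "x \<notin> ball z \<epsilon>" using \<epsilon>(2) by auto
    then have "\<epsilon> \<le> norm (x - z)" by (simp add: dist_norm norm_minus_commute)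
    then show ?thesis unfolding x(2) i_def norm_inverse using \<epsilon>(1) by (intro le_imp_inverse_le)
  qed
  then have "bounded ?T" unfolding bounded_iff by blast
  then have T': "compact ?T" using clT compact_eq_bounded_closed by blast
  \<comment> \<open>\<open>T\<close> is unbounded, so its image accumulates at 0 and adding 0 keeps
    it connected.\<close>
  have "0 \<in> closure (i ` T)"
    unfolding closure_approachable
  proof (intro allI impI)
    fix e :: real assume e: "e > 0"
    have "\<not> (\<forall>x\<in>T. norm x \<le> norm z + inverse e)" using False unfolding bounded_iff by auto
    then obtain x where x: "x \<in> T" "norm z + inverse e < norm x" by auto
    have "norm x \<le> norm (x - z) + norm z" using norm_triangle_ineq[of "x - z" z] by simp
    then have "inverse e < norm (x - z)" using x by linarith
    then have "inverse (norm (x - z)) < inverse (inverse e)" using e by (intro less_imp_inverse_less) auto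
    then have "norm (i x) < e" unfolding i_def norm_inverse using e by simp
    then show "\<exists>y\<in>i ` T. dist y 0 < e" using x by auto
  qed
  then have conT: "connected ?T"
    by (intro connected_intermediate_closure[OF connected_continuous_image[OF conti[OF zST(2)] T(2)]])
      (use closure_subset[of "i ` T"] in auto)
  have conS: "compact ?S" "connected ?S"
    using compact_continuous_image connected_continuous_image conti[OF zST(1)] S by blast+
  \<comment> \<open>The point 0 now belongs to the image of \<open>T\<close>, so the complement
    loses \<open>z\<close>; an open connected set stays connected without one point.\<close>
  have "- (?S \<union> ?T) = i ` (- (S \<union> T) - {z})"
  proof (intro set_eqI)
    fix w
    have "j w \<noteq> z \<longleftrightarrow> w \<noteq> 0" unfolding j_def by simp
    then show "w \<in> - (?S \<union> ?T) \<longleftrightarrow> w \<in> i ` (- (S \<union> T) - {z})" using mem by auto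
  qed
  moreover have "connected (i ` (- (S \<union> T) - {z}))"
  proof (rule connected_continuous_image[OF conti])
    have "open (- (S \<union> T))" using compact_imp_closed[OF S(1)] T(1) by (intro open_Compl closed_Un)
    then show "connected (- (S \<union> T) - {z})" by (intro connected_open_delete[OF _ con]) auto
  qed auto
  ultimately have "connected (?S \<inter> ?T)"
    using Janiszewski_dual[OF conS(1) T' conS(2) conT] by simp
  moreover have "?S \<inter> ?T = i ` (S \<inter> T)"
  proof -
    have "inj i" by (metis injI ji)
    moreover have "0 \<notin> ?S" using i0 zST by force
    ultimately show ?thesis by (simp add: image_Int)
  qed
  ultimately have "connected (j ` i ` (S \<inter> T))"
    by (intro connected_continuous_image[OF contj]) (use i0 zST in auto)
  then show ?thesis by (simp add: image_image ji)
qed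

text \<open>Each complementary component touches \<open>K\<close> at a frontier point, so filling it
  in preserves connectedness.\<close>

lemma connected_Un_components:
  fixes K :: "complex set"
  assumes K: "closed K" "connected K" "K \<noteq> {}" and \<Phi>: "\<Phi> \<subseteq> components (- K)"
  shows "connected (K \<union> \<Union>\<Phi>)"
proof -
  obtain k where k: "k \<in> K" using K by auto
  have "connected (\<Union>(insert K ((\<lambda>C. C \<union> K) ` \<Phi>)))"
  proof (rule connected_Union)
    fix X assume "X \<in> insert K ((\<lambda>C. C \<union> K) ` \<Phi>)"
    then consider "X = K" | C where "C \<in> components (- K)" "X = C \<union> K" using \<Phi> by auto
    then show "connected X"
    proof cases
      case 2
      have "C \<noteq> {}" "C \<noteq> UNIV" "connected C"
        using in_components_nonempty[OF 2(1)] in_components_subset[OF 2(1)] k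
          in_components_connected[OF 2(1)] by auto
      moreover have "frontier C \<subseteq> K" using frontier_of_components_closed_complement[OF K(1) 2(1)] .
      moreover obtain x where "x \<in> frontier C"
        using frontier_eq_empty[of C] \<open>C \<noteq> {}\<close> \<open>C \<noteq> UNIV\<close> by blast
      ultimately show ?thesis unfolding 2(2)
        by (intro connected_Un_closure[of C K x]) (use K in \<open>auto simp: frontier_def\<close>)
    qed (use K in simp)
  next
    have "k \<in> \<Inter>(insert K ((\<lambda>C. C \<union> K) ` \<Phi>))" using k by auto
    then show "\<Inter>(insert K ((\<lambda>C. C \<union> K) ` \<Phi>)) \<noteq> {}" by blast
  qed
  moreover have "\<Union>(insert K ((\<lambda>C. C \<union> K) ` \<Phi>)) = K \<union> \<Union>\<Phi>" by auto
  ultimately show ?thesis by simp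
qed

text \<open>A connected set leaving \<open>F\<close> would meet its frontier, hence
  \<open>K\<close>. In particular, a face whose boundary survives in a subgraph is also a face of
  that subgraph.\<close>

lemma component_of_larger_complement:
  fixes F :: "complex set"
  assumes "connected F" "F \<noteq> {}" "F \<inter> K = {}" "frontier F \<subseteq> K"
  shows "F \<in> components (- K)"
  unfolding in_components_maximal
proof (intro conjI allI impI)
  show "F \<subseteq> - K" using assms(3) by auto
  fix D assume D: "D \<noteq> {} \<and> F \<subseteq> D \<and> D \<subseteq> - K \<and> connected D"
  show "D = F"
  proof (rule ccontr)
    assume "D \<noteq> F"
    then have "D \<inter> F \<noteq> {}" "D - F \<noteq> {}" using D assms(2) by auto
    then have "D \<inter> frontier F \<noteq> {}" using D by (intro connected_Int_frontier) auto
    then show False using D assms(4) by auto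
  qed
qed (use assms in auto)

context plane begin

lemma triangle_adjacent:
  assumes cyc: "plane_cycle V A vs as" "length vs = 3" and xy: "x \<in> set vs" "y \<in> set vs" "x \<noteq> y"
  shows "{x,y} \<in> edge_ends V A"
proof -
  obtain a b c where vs: "vs = [a,b,c]"
    using cyc(2) by (auto simp: numeral_eq_Suc length_Suc_conv)
  have "{a,b} \<in> edge_ends V A" "{b,c} \<in> edge_ends V A" "{c,a} \<in> edge_ends V A"
    using cycle_edge[OF cyc(1)[unfolded vs], of 0] cycle_edge[OF cyc(1)[unfolded vs], of "Suc 0"]
      cycle_edge[OF cyc(1)[unfolded vs], of "Suc (Suc 0)"]
    by simp_all
  moreover from this have "{b,a} \<in> edge_ends V A" "{c,b} \<in> edge_ends V A" "{a,c} \<in> edge_ends V A"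
    by (simp_all add: insert_commute)
  moreover have "x \<in> {a,b,c}" "y \<in> {a,b,c}" using xy unfolding vs by simp_all
  ultimately show ?thesis using xy(3) by (elim insertE emptyE) simp_all
qed

text \<open>At most one face is unbounded.\<close>

lemma bounded_Union_faces:
  assumes "\<Phi>1 \<subseteq> faces V A" "\<Phi>2 \<subseteq> faces V A" "\<Phi>1 \<inter> \<Phi>2 = {}"
  shows "bounded (\<Union>\<Phi>1) \<or> bounded (\<Union>\<Phi>2)"
proof -
  have "bounded (V \<union> \<Union>A)"
    unfolding bounded_Un
    by (intro conjI finite_imp_bounded[OF finite_vertices] compact_imp_bounded[OF compact_Union_edges[OF order_refl]])
  then obtain w r where r: "V \<union> \<Union>A \<subseteq> cball w r"
    unfolding bounded_subset_cball by (elim exE conjE) (rule that)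
  have con: "connected (- cball w r)"
    by (intro connected_complement_bounded_convex) auto
  have sub: "F \<subseteq> cball w r" if F: "F \<in> faces V A" "F' \<in> faces V A" "F \<noteq> F'" "x \<in> F'" "x \<notin> cball w r" for F F' x
  proof -
    have out: "- cball w r \<subseteq> - (V \<union> \<Union>A)" using r by (rule compl_mono)
    have F': "F' \<in> components (- (V \<union> \<Union>A))" using F(2) unfolding faces_def .
    have "- cball w r \<subseteq> F'"
      by (rule components_maximal[OF F' con out]) (use F(4,5) in auto)
    then show ?thesis using faces_disjoint[OF F(1-3)] by auto
  qed
  have "\<Union>\<Phi>1 \<subseteq> cball w r \<or> \<Union>\<Phi>2 \<subseteq> cball w r"
  proof (rule ccontr)
    assume "\<not> ?thesis"
    then have n: "\<not> \<Union>\<Phi>1 \<subseteq> cball w r" "\<not> \<Union>\<Phi>2 \<subseteq> cball w r" by simp_all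
    obtain x F where x: "x \<in> F" "F \<in> \<Phi>1" "x \<notin> cball w r" using n(1) by blast
    obtain y G where y: "y \<in> G" "G \<in> \<Phi>2" "y \<notin> cball w r" using n(2) by blast
    have "F \<noteq> G" using assms(3) x(2) y(2) by auto
    moreover have "F \<in> faces V A" "G \<in> faces V A" using assms(1,2) x(2) y(2) by auto
    ultimately have "F \<subseteq> cball w r" using sub[OF _ _ _ y(1,3)] by simp
    then show False using x(1,3) by (meson subsetD)
  qed
  then show ?thesis using bounded_subset[OF bounded_cball] by auto
qed

end

section \<open>The two sides of a minimal cut\<close>

lemma split_disconnected:
  assumes "\<not> conn E W"
  obtains C where "C \<subseteq> W" "conn E C" "C \<noteq> {}" "W - C \<noteq> {}"
    "\<And>x y. \<lbrakk>x \<in> C; y \<in> W - C\<rbrakk> \<Longrightarrow> {x,y} \<notin> E"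
proof -
  have "W \<noteq> {}" using assms by auto
  then obtain u where "u \<in> W" by auto
  then obtain C where C: "u \<in> C" "C \<subseteq> W" "conn E C"
    "\<And>x y. \<lbrakk>x \<in> C; y \<in> W; {x,y} \<in> E\<rbrakk> \<Longrightarrow> y \<in> C"
    using conn_component[of u W E] by metis
  moreover have "C \<noteq> W" using C(3) assms by auto
  ultimately show ?thesis using that[of C] by blast
qed

text \<open>Otherwise \<open>C\<close> would remain cut off after \<open>s\<close> is put back,
  against minimality.\<close>

lemma minimal_cut_neighbour:
  assumes S: "minimal_cut V E S" and s: "s \<in> S"
    and C: "C \<subseteq> V - S" "C \<noteq> {}" "\<And>x y. \<lbrakk>x \<in> C; y \<in> V - S - C\<rbrakk> \<Longrightarrow> {x,y} \<notin> E"
  obtains c where "c \<in> C" "{c,s} \<in> E"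
proof (rule ccontr)
  assume not: "\<not> thesis"
  have "S - {s} \<subset> S" using s by auto
  then have con: "conn E (V - (S - {s}))" using S unfolding minimal_cut_def by simp
  have "C = V - (S - {s})"
  proof (rule conn_closedD[OF con _ C(2)])
    show "C \<subseteq> V - (S - {s})" using C(1) by auto
    fix x y assume xy: "x \<in> C" "y \<in> V - (S - {s})" "{x,y} \<in> E"
    then have "y \<noteq> s" using not that by auto
    then show "y \<in> C" using C(3)[of x y] xy by auto
  qed
  moreover have "s \<in> V" using S s unfolding minimal_cut_def graph_cut_def by auto
  ultimately show False using C(1) s by auto
qed

context plane_2_connected begin

lemma at_most_one_large_face_cleavable:
  assumes few: "\<exists>\<^sub>\<le>\<^sub>1 F. large_face V A F"
  shows "cleavable V (edge_ends V A)"
  unfolding cleavable_def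
proof (intro allI impI, rule ccontr)
  let ?E = "edge_ends V A"
  fix S assume S: "minimal_cut V ?E S" and "\<not> conn ?E S"
  have SV: "S \<subseteq> V" "\<not> conn ?E (V - S)" using S unfolding minimal_cut_def graph_cut_def by auto
  obtain C where C: "C \<subseteq> V - S" "conn ?E C" "C \<noteq> {}" "V - S - C \<noteq> {}"
    "\<And>x y. \<lbrakk>x \<in> C; y \<in> V - S - C\<rbrakk> \<Longrightarrow> {x,y} \<notin> ?E"
    using split_disconnected[OF SV(2)] by metis
  obtain P where P: "P \<subseteq> S" "P \<noteq> {}" "S - P \<noteq> {}"
    "\<And>x y. \<lbrakk>x \<in> P; y \<in> S - P\<rbrakk> \<Longrightarrow> {x,y} \<notin> ?E"
    using split_disconnected[OF \<open>\<not> conn ?E S\<close>] by metis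
  have PV: "P \<subseteq> V" "C \<subseteq> V" "P \<inter> C = {}" using P SV C by auto
  have nbr: "\<exists>c\<in>C. {c,s} \<in> ?E" "\<exists>c\<in>V - S - C. {c,s} \<in> ?E" if s: "s \<in> S" for s
  proof -
    show "\<exists>c\<in>C. {c,s} \<in> ?E" using minimal_cut_neighbour[OF S s C(1,3,5)] by metis
    have sub: "V - S - C \<subseteq> V - S" by auto
    have "{x,y} \<notin> ?E" if "x \<in> V - S - C" "y \<in> V - S - (V - S - C)" for x y
      using C(5)[of y x] that by (auto simp: insert_commute)
    then show "\<exists>c\<in>V - S - C. {c,s} \<in> ?E" using minimal_cut_neighbour[OF S s sub C(4)] by metis
  qed
  define D where "D = {a \<in> A. \<exists>p\<in>P. \<exists>c\<in>C. a \<inter> V = {p,c}}"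
  let ?A' = "A - D"
  let ?E' = "edge_ends V ?A'"
  interpret sub: plane V ?A' by unfold_locales (rule plane_graph_subset[OF plane], auto)
  define H where "H = realize V A (P \<union> C)"
  define K where "K = realize V ?A' V"
  have Keq: "K = V \<union> \<Union>?A'" unfolding K_def realize_def by auto
  have HG: "H \<subseteq> V \<union> \<Union>A" unfolding H_def realize_def using PV by auto
  have KG: "K \<subseteq> V \<union> \<Union>A" unfolding Keq by auto
  have clH: "closed H" unfolding H_def using PV by (intro compact_imp_closed compact_realize) auto
  have clK: "closed K" unfolding K_def by (intro compact_imp_closed sub.compact_realize) auto
  have bHK: "bounded H" "bounded K"
    unfolding H_def K_def using PV by (auto intro!: compact_imp_bounded compact_realize sub.compact_realize)
  have conH: "connected H" unfolding H_def
  proof (rule connected_realize)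
    show "P \<union> C \<subseteq> V" using PV by auto
    have "conn ?E (C \<union> P)" by (rule conn_add_neighbours[OF C(2)]) (use nbr(1) P(1) in auto)
    then show "conn ?E (P \<union> C)" by (simp add: Un_commute)
  qed
  have E'I: "e \<in> ?E'" if "e \<in> ?E" "\<And>p c. \<lbrakk>p \<in> P; c \<in> C\<rbrakk> \<Longrightarrow> e \<noteq> {p,c}" for e
    using that unfolding edge_ends_def D_def by auto
  have conK: "connected K" unfolding K_def
  proof (rule sub.connected_realize)
    obtain q where q: "q \<in> S - P" using P(3) by auto
    obtain c where c: "c \<in> C" using C(3) by auto
    \<comment> \<open>By minimality the graph left by deleting \<open>S - {q}\<close> is connected.
      It has no vertex in \<open>P\<close>, so no edge of \<open>D\<close> is lost. These graphs
      overlap in \<open>V - S\<close>.\<close>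
    have "conn ?E' (\<Union>q\<in>S - P. insert q (V - S))"
    proof (rule conn_UnionI)
      fix X assume "X \<in> (\<lambda>q. insert q (V - S)) ` (S - P)"
      then obtain q where q: "q \<in> S - P" "X = insert q (V - S)" by auto
      have "S - {q} \<subset> S" using q by auto
      then have "conn ?E (V - (S - {q}))" using S unfolding minimal_cut_def by simp
      moreover have "V - (S - {q}) = X" using q SV(1) by auto
      ultimately have con: "conn ?E X" by simp
      show "conn ?E' X"
      proof (rule conn_mono_edges[OF con])
        fix e assume e: "e \<in> ?E" "e \<subseteq> X"
        show "e \<in> ?E'" by (rule E'I[OF e(1)]) (use e(2) q P(1) in auto)
      qed
      show "c \<in> X" using q c C(1) by auto
    qed
    moreover have "(\<Union>q\<in>S - P. insert q (V - S)) = (S - P) \<union> (V - S)" using q by auto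
    ultimately have "conn ?E' ((S - P) \<union> (V - S))" by simp
    then have "conn ?E' (((S - P) \<union> (V - S)) \<union> P)"
    proof (rule conn_add_neighbours)
      fix p assume p: "p \<in> P"
      then obtain d where d: "d \<in> V - S - C" "{d,p} \<in> ?E" using nbr(2)[of p] P(1) by auto
      \<comment> \<open>The neighbour of \<open>p\<close> is taken on the side away from
        \<open>C\<close>, so this edge is not in \<open>D\<close>.\<close>
      have "{d,p} \<in> ?E'"
      proof (rule E'I[OF d(2)])
        fix p' c' assume pc: "p' \<in> P" "c' \<in> C"
        then have "d \<noteq> p'" "d \<noteq> c'" using d(1) P(1) by auto
        then show "{d,p} \<noteq> {p',c'}" by (auto simp: doubleton_eq_iff)
      qed
      then show "\<exists>v\<in>(S - P) \<union> (V - S). {v,p} \<in> ?E'" using d(1) by auto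
    qed
    moreover have "((S - P) \<union> (V - S)) \<union> P = V" using SV(1) P(1) by auto
    ultimately show "conn ?E' V" by simp
  qed simp
  \<comment> \<open>An edge of \<open>H\<close> that survives in \<open>K\<close> does not join
    \<open>P\<close> to \<open>C\<close>, so both its ends lie on the same side.\<close>
  have HK: "H \<inter> K \<subseteq> realize V A P \<union> realize V A C"
  proof
    fix x assume x: "x \<in> H \<inter> K"
    show "x \<in> realize V A P \<union> realize V A C"
    proof (cases "x \<in> V")
      case True
      then have "x \<in> P \<union> C" using x unfolding H_def realize_def by auto
      then show ?thesis unfolding realize_def by auto
    next
      case False
      obtain a where a: "a \<in> A" "a \<inter> V \<subseteq> P \<union> C" "x \<in> a"
        using x False PV unfolding H_def realize_def by auto
      obtain b where b: "b \<in> A" "b \<notin> D" "x \<in> b" using x False unfolding Keq by auto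
      have "a = b" using edge_Int[OF a(1) b(1)] a b False by auto
      then have aD: "a \<notin> D" using b by simp
      obtain u v where uv: "a \<inter> V = {u,v}" using edge_ends2[OF a(1)] by metis
      have "\<not> (u \<in> P \<and> v \<in> C)" "\<not> (v \<in> P \<and> u \<in> C)"
        using aD a(1) uv unfolding D_def by (auto simp: insert_commute)
      then have "a \<inter> V \<subseteq> P \<or> a \<inter> V \<subseteq> C" using uv a(2) by auto
      then show ?thesis using edge_subset_realize[OF a(1)] a(3) by auto
    qed
  qed
  have disj: "realize V A P \<inter> realize V A C = {}" by (rule realize_disjoint[OF PV])
  have nc: "\<not> connected (H \<inter> K)"
  proof
    assume con: "connected (H \<inter> K)"
    have cl: "closed (realize V A P)" "closed (realize V A C)"
      using PV by (simp_all add: compact_imp_closed compact_realize)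
    have "realize V A P \<inter> realize V A C \<inter> (H \<inter> K) = {}" using disj by auto
    then have "realize V A P \<inter> (H \<inter> K) = {} \<or> realize V A C \<inter> (H \<inter> K) = {}"
      by (rule connected_closedD[OF con _ HK cl])
    moreover have "P \<subseteq> realize V A P \<inter> (H \<inter> K)" "C \<subseteq> realize V A C \<inter> (H \<inter> K)"
      unfolding H_def Keq realize_def using PV by auto
    ultimately show False using P(2) C(3) by auto
  qed
  \<comment> \<open>If no face is large, \<open>F0\<close> is arbitrary and need not be a face. It
    is left unfilled in either case.\<close>
  obtain F0 where F0: "\<And>F. large_face V A F \<Longrightarrow> F = F0"
    using few unfolding Uniq_def by (cases "\<exists>F. large_face V A F") auto
  have HorK: "frontier F \<subseteq> H \<or> frontier F \<subseteq> K" if F: "F \<in> faces V A" "F \<noteq> F0" for F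
  proof -
    obtain vs as where cyc: "plane_cycle V A vs as" "frontier F = \<Union>(set as)"
      using face_boundary_cycle[OF F(1)] .
    note c = cycle_facts[OF cyc(1)]
    have "\<not> large_face V A F" using F0 F(2) by auto
    then have "\<not> 4 \<le> length as" using F(1) cyc unfolding large_face_def by auto
    then have l3: "length vs = 3" using c(1,2) by simp
    show ?thesis
    proof (cases "set as \<inter> D = {}")
      case True
      then have "set as \<subseteq> ?A'" using c(5) by auto
      then show ?thesis unfolding cyc(2) Keq by auto
    next
      case False
      then obtain a where a: "a \<in> set as" "a \<in> D" by auto
      then obtain p q where pq: "p \<in> P" "q \<in> C" "a \<inter> V = {p,q}" unfolding D_def by auto
      have V: "V \<inter> \<Union>(set as) = set vs" by (rule cycle_vertices[OF cyc(1)])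
      have pqv: "p \<in> set vs" "q \<in> set vs" using pq(3) a(1) unfolding V[symmetric] by auto
      \<comment> \<open>Another vertex of the triangle is adjacent to \<open>p\<close>, which
        excludes \<open>S - P\<close>, and to \<open>q\<close>, which excludes
        \<open>V - S - C\<close>.\<close>
      have "x \<in> P \<union> C" if x: "x \<in> set vs" for x
      proof (rule ccontr)
        assume nx: "x \<notin> P \<union> C"
        then have "{p,x} \<in> ?E" "{q,x} \<in> ?E"
          using triangle_adjacent[OF cyc(1) l3] pqv x pq by auto
        moreover have "x \<in> V" using x c(4) by auto
        ultimately show False using P(4)[OF pq(1), of x] C(5)[OF pq(2), of x] nx by auto
      qed
      then have "b \<subseteq> H" if "b \<in> set as" for b
        unfolding H_def using that c(5) V by (intro edge_subset_realize) auto
      then show ?thesis unfolding cyc(2) by auto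
    qed
  qed
  \<comment> \<open>A face whose boundary lies in both sets is assigned to \<open>\<Phi>2\<close>
    only; the families have to be disjoint, as otherwise filling would enlarge the
    intersection.\<close>
  define \<Phi>1 where "\<Phi>1 = {F \<in> faces V A. F \<noteq> F0 \<and> frontier F \<subseteq> H \<and> \<not> frontier F \<subseteq> K}"
  define \<Phi>2 where "\<Phi>2 = {F \<in> faces V A. F \<noteq> F0 \<and> frontier F \<subseteq> K}"
  have \<Phi>: "\<Phi>1 \<subseteq> faces V A" "\<Phi>2 \<subseteq> faces V A" "\<Phi>1 \<inter> \<Phi>2 = {}" unfolding \<Phi>1_def \<Phi>2_def by auto
  have Fdisj: "F \<inter> H = {}" "F \<inter> K = {}" if "F \<in> faces V A" for F
  proof -
    have "F \<inter> (V \<union> \<Union>A) = {}" using face_facts(3,4)[OF that] by (simp add: Int_Un_distrib)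
    moreover have "F \<inter> H \<subseteq> F \<inter> (V \<union> \<Union>A)" "F \<inter> K \<subseteq> F \<inter> (V \<union> \<Union>A)"
      by (intro Int_mono order_refl HG KG)+
    ultimately show "F \<inter> H = {}" "F \<inter> K = {}" by simp_all
  qed
  have comp: "\<Phi>1 \<subseteq> components (- H)" "\<Phi>2 \<subseteq> components (- K)"
    using component_of_larger_complement face_facts(1,2) Fdisj unfolding \<Phi>1_def \<Phi>2_def by auto
  let ?X = "H \<union> \<Union>\<Phi>1" and ?Y = "K \<union> \<Union>\<Phi>2"
  have ne: "H \<noteq> {}" "K \<noteq> {}" unfolding H_def Keq realize_def using C(3) PV by auto
  have X: "closed ?X" "connected ?X"
    using closed_union_complement_components[OF clH comp(1)]
      connected_Un_components[OF clH conH ne(1) comp(1)] by simp_all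
  have Y: "closed ?Y" "connected ?Y"
    using closed_union_complement_components[OF clK comp(2)]
      connected_Un_components[OF clK conK ne(2) comp(2)] by simp_all
  have HKeq: "H \<union> K = V \<union> \<Union>A"
  proof
    have "a \<subseteq> H" if "a \<in> D" for a
    proof -
      obtain p c where "a \<in> A" "p \<in> P" "c \<in> C" "a \<inter> V = {p,c}" using \<open>a \<in> D\<close> unfolding D_def by auto
      then show ?thesis unfolding H_def by (intro edge_subset_realize) simp_all
    qed
    then show "V \<union> \<Union>A \<subseteq> H \<union> K" unfolding Keq by auto
  qed (use HG KG in auto)
  have "- (?X \<union> ?Y) = - (H \<union> K) - \<Union>(\<Phi>1 \<union> \<Phi>2)" by auto
  moreover have "- (H \<union> K) = \<Union>(faces V A)" unfolding HKeq faces_def by (rule Union_components[symmetric])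
  moreover have "\<Phi>1 \<union> \<Phi>2 = faces V A - {F0}" using HorK unfolding \<Phi>1_def \<Phi>2_def by auto
  ultimately have "- (?X \<union> ?Y) = \<Union>(faces V A) - \<Union>(faces V A - {F0})" by simp
  \<comment> \<open>What stays unfilled is \<open>F0\<close> or nothing, and both are
    connected.\<close>
  moreover have "\<Union>(faces V A) - \<Union>(faces V A - {F0}) = (if F0 \<in> faces V A then F0 else {})"
    using faces_disjoint by auto
  ultimately have con: "connected (- (?X \<union> ?Y))" using face_facts(1) by simp
  have "connected (?X \<inter> ?Y)"
  \<comment> \<open>At most one of the two filled sets is unbounded, and the other takes the compact
    place.\<close>
  proof (cases "bounded (\<Union>\<Phi>1)")
    case True
    then have "compact ?X" using bHK X(1) by (simp add: compact_eq_bounded_closed)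
    then show ?thesis using X Y con by (intro Janiszewski_dual_closed) auto
  next
    case False
    then have "bounded (\<Union>\<Phi>2)" using bounded_Union_faces[OF \<Phi>] by auto
    then have "compact ?Y" using bHK Y(1) by (simp add: compact_eq_bounded_closed)
    then have "connected (?Y \<inter> ?X)" using X Y con by (intro Janiszewski_dual_closed) (auto simp: Un_commute)
    then show ?thesis by (simp add: Int_commute)
  qed
  moreover have "?X \<inter> ?Y = H \<inter> K"
  proof -
    have "F \<inter> G = {}" if "F \<in> \<Phi>1" "G \<in> \<Phi>2" for F G
      using faces_disjoint[of F G] that \<Phi> by auto
    then have "\<Union>\<Phi>1 \<inter> \<Union>\<Phi>2 = {}" by auto
    moreover have "F \<inter> K = {}" if "F \<in> \<Phi>1" for F by (rule Fdisj(2)) (use that \<Phi>(1) in auto)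
    then have "\<Union>\<Phi>1 \<inter> K = {}" by auto
    moreover have "F \<inter> H = {}" if "F \<in> \<Phi>2" for F by (rule Fdisj(1)) (use that \<Phi>(2) in auto)
    then have "\<Union>\<Phi>2 \<inter> H = {}" by auto
    ultimately show ?thesis by auto
  qed
  ultimately show False using nc by simp
qed

end

theorem theorem17:
  fixes V :: "complex set" and A :: "complex set set"
  assumes "plane_graph V A"
    and "k_connected 4 V (edge_ends V A)"
  shows "(cleavable V (edge_ends V A) \<longleftrightarrow> (\<exists>\<^sub>\<le>\<^sub>1 F. large_face V A F)) \<and>
         (cleavable V (edge_ends V A) \<longleftrightarrow> near_triangulation V A)"
proof -
  have k2: "k_connected 2 V (edge_ends V A)"
    using assms(2) unfolding k_connected_def by simp
  interpret plane_2_connected V A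
    by unfold_locales (use assms k2 in auto)
  have "cleavable V (edge_ends V A) \<longleftrightarrow> (\<exists>\<^sub>\<le>\<^sub>1 F. large_face V A F)"
    using cleavable_large_face_unique[OF assms(2)] at_most_one_large_face_cleavable
    by (auto intro: Uniq_I)
  then show ?thesis unfolding near_triangulation_def using assms(1) k2 by simp
qed

end
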